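(* Let $V$ be a right quaternionic Hilbert space and $A\in\mathcal B(V)$. Then: (a) $\rho_{ka}^S(A)=\rho_{ka}^S(A^\dagger)$; (b) $\rho_{ka}^S(A)\cap\sigma_S(A)\subseteq S(A)\cup S(A^\dagger)$; (c) $\partial\sigma_S(A)\subseteq\big(\sigma_{ap}^S(A)\cap\sigma_{su}^S(A)\big)\setminus\big(S(A)\cap S(A^\dagger)\big)\subseteq\sigma_{ka}^S(A)\subseteq\sigma_{ap}^S(A)\cap\sigma_{su}^S(A)$; (d) $\big(\sigma_{ap}^S(A)\cap\sigma_{su}^S(A)\big)\setminus\big(S(A)\cap S(A^\dagger)\big)=\big(\sigma_{ap}^S(A)\setminus S(A)\big)\cup\big(\sigma_{su}^S(A)\setminus S(A^\dagger)\big)$.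
   Context: $\mathbb H$ denotes the quaternions. A right quaternionic Hilbert space $V$ is a right $\mathbb H$-vector space with an $\mathbb H$-valued inner product satisfying $\overline{\langle\phi|\psi\rangle}=\langle\psi|\phi\rangle$, additivity, $\langle\phi|\psi\mathfrak q\rangle=\langle\phi|\psi\rangle\mathfrak q$, $\langle\phi\mathfrak q|\psi\rangle=\overline{\mathfrak q}\langle\phi|\psi\rangle$ and $\|\phi\|^2=\langle\phi|\phi\rangle>0$ for $\phi\ne0$, complete in this norm and separable. $\mathcal B(V)$ is the set of bounded right $\mathbb H$-linear operators $V\to V$; $A^\dagger$ is the adjoint, $\langle\psi|A\phi\rangle=\langle A^\dagger\psi|\phi\rangle$. For $\mathfrak q\in\mathbb H$, $R_{\mathfrak q}(A)=A^2-2\,\mathrm{Re}(\mathfrak q)A+|\mathfrak q|^2 I$. S-spectrum: $\sigma_S(A)=\{\mathfrak q: R_{\mathfrak q}(A)\text{ has no inverse in }\mathcal B(V)\}$; $\partial\sigma_S(A)$ is its boundary in $\mathbb H$. Approximate S-point spectrum: $\sigma_{ap}^S(A)=\{\mathfrak q:\exists\,(\phi_n),\ \|\phi_n\|=1,\ \|R_{\mathfrak q}(A)\phi_n\|\to0\}$. Surjectivity S-spectrum: $\sigma_{su}^S(A)=\{\mathfrak q:\mathrm{ran}(R_{\mathfrak q}(A))\ne V\}$. Kato S-resolvent set: $\rho_{ka}^S(A)$ is the set of $\mathfrak q\in\mathbb H$ such that $\mathrm{ran}(R_{\mathfrak q}(A))$ is closed and $\ker(R_{\mathfrak q}(A))\subseteq\bigcap_{n\in\mathbb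 N}\mathrm{ran}(R_{\mathfrak q}(A)^n)$; $\sigma_{ka}^S(A)=\mathbb H\setminus\rho_{ka}^S(A)$. Let $\mathbb S=\{I\in\mathbb H: I^2=-1\}$ and $L_I=\mathbb R+I\mathbb R$. A real differentiable function $f:U\to V$ on an open set $U\subseteq\mathbb H$ is right slice-regular if for every $I\in\mathbb S$ the restriction $f_I=f|_{U\cap L_I}$ has continuous partial derivatives and satisfies $\frac{\partial f_I(x+yI)}{\partial x}+\frac{\partial f_I(x+yI)}{\partial y}I=0$ on $U\cap L_I$. Analytic residuum: $S(A)$ is the (open) set of points $\mathfrak q\in\mathbb H$ for which there exist an open neighborhood $U$ of $\mathfrak q$ and a continuous right slice-regular function $f:U\to V$, non-vanishing (i.e. $f(\mathfrak p)\neq0$ for all $\mathfrak p\in U$), such that $R_{\mathfrak p}(A)f(\mathfrak p)=0$ for all $\mathfrak p\in U$. *)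

theory Defs
  imports "HOL-Analysis.Analysis"
begin

section \<open>The quaternions\<close>

datatype quat = Quat (qRe: real) (qIm1: real) (qIm2: real) (qIm3: real)

lemma quat_eq_iff:
  "p = q \<longleftrightarrow> qRe p = qRe q \<and> qIm1 p = qIm1 q \<and> qIm2 p = qIm2 q \<and> qIm3 p = qIm3 q"
  by (cases p; cases q) auto

instantiation quat :: ab_group_add
begin

definition zero_quat :: quat
  where "0 = Quat 0 0 0 0"

definition plus_quat :: "quat \<Rightarrow> quat \<Rightarrow> quat"
  where "p + q = Quat (qRe p + qRe q) (qIm1 p + qIm1 q) (qIm2 p + qIm2 q) (qIm3 p + qIm3 q)"

definition uminus_quat :: "quat \<Rightarrow> quat"
  where "- p = Quat (- qRe p) (- qIm1 p) (- qIm2 p) (- qIm3 p)"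

definition minus_quat :: "quat \<Rightarrow> quat \<Rightarrow> quat"
  where "p - q = Quat (qRe p - qRe q) (qIm1 p - qIm1 q) (qIm2 p - qIm2 q) (qIm3 p - qIm3 q)"

instance
  by standard (auto simp: quat_eq_iff zero_quat_def plus_quat_def uminus_quat_def minus_quat_def)

end

lemma quat_add_simps [simp]:
  "qRe 0 = 0" "qIm1 0 = 0" "qIm2 0 = 0" "qIm3 0 = 0"
  "qRe (p + q) = qRe p + qRe q" "qIm1 (p + q) = qIm1 p + qIm1 q"
  "qIm2 (p + q) = qIm2 p + qIm2 q" "qIm3 (p + q) = qIm3 p + qIm3 q"
  "qRe (- p) = - qRe p" "qIm1 (- p) = - qIm1 p" "qIm2 (- p) = - qIm2 p" "qIm3 (- p) = - qIm3 p"
  "qRe (p - q) = qRe p - qRe q" "qIm1 (p - q) = qIm1 p - qIm1 q"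
  "qIm2 (p - q) = qIm2 p - qIm2 q" "qIm3 (p - q) = qIm3 p - qIm3 q"
  by (auto simp: zero_quat_def plus_quat_def uminus_quat_def minus_quat_def)

instantiation quat :: ring_1
begin

definition one_quat :: quat
  where "1 = Quat 1 0 0 0"

definition times_quat :: "quat \<Rightarrow> quat \<Rightarrow> quat"
  where "p * q = Quat
    (qRe p * qRe q - qIm1 p * qIm1 q - qIm2 p * qIm2 q - qIm3 p * qIm3 q)
    (qRe p * qIm1 q + qIm1 p * qRe q + qIm2 p * qIm3 q - qIm3 p * qIm2 q)
    (qRe p * qIm2 q - qIm1 p * qIm3 q + qIm2 p * qRe q + qIm3 p * qIm1 q)
    (qRe p * qIm3 q + qIm1 p * qIm2 q - qIm2 p * qIm1 q + qIm3 p * qRe q)"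

instance
  by standard (auto simp: quat_eq_iff one_quat_def times_quat_def algebra_simps)

end

lemma quat_mult_simps [simp]:
  "qRe 1 = 1" "qIm1 1 = 0" "qIm2 1 = 0" "qIm3 1 = 0"
  "qRe (p * q) = qRe p * qRe q - qIm1 p * qIm1 q - qIm2 p * qIm2 q - qIm3 p * qIm3 q"
  "qIm1 (p * q) = qRe p * qIm1 q + qIm1 p * qRe q + qIm2 p * qIm3 q - qIm3 p * qIm2 q"
  "qIm2 (p * q) = qRe p * qIm2 q - qIm1 p * qIm3 q + qIm2 p * qRe q + qIm3 p * qIm1 q"
  "qIm3 (p * q) = qRe p * qIm3 q + qIm1 p * qIm2 q - qIm2 p * qIm1 q + qIm3 p * qRe q"
  by (auto simp: one_quat_def times_quat_def)

instantiation quat :: real_inner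
begin

definition scaleR_quat :: "real \<Rightarrow> quat \<Rightarrow> quat"
  where "r *\<^sub>R p = Quat (r * qRe p) (r * qIm1 p) (r * qIm2 p) (r * qIm3 p)"

definition inner_quat :: "quat \<Rightarrow> quat \<Rightarrow> real"
  where "p \<bullet> q = qRe p * qRe q + qIm1 p * qIm1 q + qIm2 p * qIm2 q + qIm3 p * qIm3 q"

definition norm_quat :: "quat \<Rightarrow> real"
  where "norm_quat p = sqrt ((qRe p)\<^sup>2 + (qIm1 p)\<^sup>2 + (qIm2 p)\<^sup>2 + (qIm3 p)\<^sup>2)"

definition sgn_quat :: "quat \<Rightarrow> quat"
  where "sgn_quat p = inverse (norm p) *\<^sub>R p"

definition dist_quat :: "quat \<Rightarrow> quat \<Rightarrow> real"
  where "dist_quat p q = norm (p - q)"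

definition uniformity_quat :: "(quat \<times> quat) filter"
  where "uniformity_quat = (INF e\<in>{0 <..}. principal {(p, q). dist p q < e})"

definition open_quat :: "quat set \<Rightarrow> bool"
  where "open_quat U \<longleftrightarrow> (\<forall>p\<in>U. eventually (\<lambda>(p', q). p' = p \<longrightarrow> q \<in> U) uniformity)"

instance
proof
  fix r s :: real and p q x :: quat and U :: "quat set"
  show "r *\<^sub>R (p + q) = r *\<^sub>R p + r *\<^sub>R q" "(r + s) *\<^sub>R p = r *\<^sub>R p + s *\<^sub>R p"
    "r *\<^sub>R s *\<^sub>R p = (r * s) *\<^sub>R p" "1 *\<^sub>R p = p"
    by (auto simp: quat_eq_iff scaleR_quat_def algebra_simps)
  show "p \<bullet> q = q \<bullet> p" "(p + q) \<bullet> x = p \<bullet> x + q \<bullet> x" "(r *\<^sub>R p) \<bullet> q = r * (p \<bullet> q)"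
    by (auto simp: inner_quat_def scaleR_quat_def algebra_simps)
  show "0 \<le> p \<bullet> p"
    by (simp add: inner_quat_def)
  show "(p \<bullet> p = 0) = (p = 0)"
    by (simp add: inner_quat_def quat_eq_iff add_nonneg_eq_0_iff)
  show "norm p = sqrt (p \<bullet> p)"
    by (simp add: norm_quat_def inner_quat_def power2_eq_square)
  show "sgn p = inverse (norm p) *\<^sub>R p" "dist p q = norm (p - q)"
    by (simp_all add: sgn_quat_def dist_quat_def)
  show "uniformity = (INF e\<in>{0 <..}. principal {(p, q :: quat). dist p q < e})"
    by (rule uniformity_quat_def)
  show "open U \<longleftrightarrow> (\<forall>p\<in>U. \<forall>\<^sub>F (p', q) in uniformity. p' = p \<longrightarrow> q \<in> U)"
    by (rule open_quat_def)
qed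

end

lemma quat_scaleR_simps [simp]:
  "qRe (r *\<^sub>R p) = r * qRe p" "qIm1 (r *\<^sub>R p) = r * qIm1 p"
  "qIm2 (r *\<^sub>R p) = r * qIm2 p" "qIm3 (r *\<^sub>R p) = r * qIm3 p"
  by (auto simp: scaleR_quat_def)

definition qcnj :: "quat \<Rightarrow> quat"
  where "qcnj p = Quat (qRe p) (- qIm1 p) (- qIm2 p) (- qIm3 p)"

instantiation quat :: inverse
begin

definition inverse_quat :: "quat \<Rightarrow> quat"
  where "inverse p = inverse ((norm p)\<^sup>2) *\<^sub>R qcnj p"

definition divide_quat :: "quat \<Rightarrow> quat \<Rightarrow> quat"
  where "divide_quat p q = p * inverse q"

instance ..

end

instance quat :: real_normed_div_algebra
proof
  fix r :: real and p q :: quat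
  show "(r *\<^sub>R p) * q = r *\<^sub>R (p * q)" "p * (r *\<^sub>R q) = r *\<^sub>R (p * q)"
    by (auto simp: quat_eq_iff algebra_simps)
  show "p / q = p * inverse q"
    by (rule divide_quat_def)
  show "inverse (0 :: quat) = 0"
    by (simp add: inverse_quat_def qcnj_def quat_eq_iff)
  have nsq: "(norm p)\<^sup>2 = (qRe p)\<^sup>2 + (qIm1 p)\<^sup>2 + (qIm2 p)\<^sup>2 + (qIm3 p)\<^sup>2"
    by (simp add: norm_quat_def)
  {
    assume "p \<noteq> 0"
    then have nz: "(norm p)\<^sup>2 \<noteq> 0"
      by simp
    have "qcnj p * p = (norm p)\<^sup>2 *\<^sub>R 1" "p * qcnj p = (norm p)\<^sup>2 *\<^sub>R 1"
      unfolding nsq by (auto simp: quat_eq_iff qcnj_def power2_eq_square algebra_simps)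
    moreover have "(inverse ((norm p)\<^sup>2) *\<^sub>R qcnj p) * p = inverse ((norm p)\<^sup>2) *\<^sub>R (qcnj p * p)"
      "p * (inverse ((norm p)\<^sup>2) *\<^sub>R qcnj p) = inverse ((norm p)\<^sup>2) *\<^sub>R (p * qcnj p)"
      by (auto simp: quat_eq_iff algebra_simps)
    ultimately show "inverse p * p = 1" "p * inverse p = 1"
      using nz by (simp_all add: inverse_quat_def)
  }
  show "norm (p * q) = norm p * norm q"
    unfolding norm_quat_def real_sqrt_mult [symmetric]
    by (rule arg_cong [where f = sqrt]) (simp add: power2_eq_square algebra_simps)
qed

lemma quat_cnj_simps [simp]:
  "qRe (qcnj p) = qRe p" "qIm1 (qcnj p) = - qIm1 p"
  "qIm2 (qcnj p) = - qIm2 p" "qIm3 (qcnj p) = - qIm3 p"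
  by (auto simp: qcnj_def)

lemma quat_of_real_simps [simp]:
  "qRe (of_real r) = r" "qIm1 (of_real r) = 0" "qIm2 (of_real r) = 0" "qIm3 (of_real r) = 0"
  by (auto simp: of_real_def)

instantiation quat :: euclidean_space
begin

definition Basis_quat :: "quat set"
  where "Basis = {Quat 1 0 0 0, Quat 0 1 0 0, Quat 0 0 1 0, Quat 0 0 0 1}"

instance
proof
  show "(Basis :: quat set) \<noteq> {}" "finite (Basis :: quat set)"
    by (simp_all add: Basis_quat_def)
  show "u \<bullet> v = (if u = v then 1 else 0)" if "u \<in> Basis" "v \<in> Basis" for u v :: quat
    using that unfolding Basis_quat_def by (elim insertE emptyE) (simp_all add: inner_quat_def)
  show "(\<forall>u\<in>Basis. p \<bullet> u = 0) \<longleftrightarrow> p = 0" for p :: quat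
    by (simp add: Basis_quat_def inner_quat_def quat_eq_iff [of p])
qed

end


section \<open>Right quaternionic Hilbert spaces\<close>

text \<open>
  The real structure is the one induced by the right \<open>\<bbbH>\<close>-action, the norm is the one induced
  by the inner product, completeness is part of \<^class>\<open>banach\<close>.  The triangle inequality
  and the homogeneity of the norm, which come with \<^class>\<open>banach\<close>, are consequences of the
  other axioms (Cauchy--Schwarz), so they are no additional restriction.
\<close>

class right_quat_hilbert = banach +
  fixes qscale :: "'a \<Rightarrow> quat \<Rightarrow> 'a"  (infixl \<open>*\<^sub>H\<close> 75)
    and qinner :: "'a \<Rightarrow> 'a \<Rightarrow> quat"
  assumes qscale_add_left: "(\<phi> + \<psi>) *\<^sub>H q = \<phi> *\<^sub>H q + \<psi> *\<^sub>H q"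
    and qscale_add_right: "\<phi> *\<^sub>H (p + q) = \<phi> *\<^sub>H p + \<phi> *\<^sub>H q"
    and qscale_qscale: "(\<phi> *\<^sub>H p) *\<^sub>H q = \<phi> *\<^sub>H (p * q)"
    and qscale_one: "\<phi> *\<^sub>H 1 = \<phi>"
    and scaleR_eq_qscale: "r *\<^sub>R \<phi> = \<phi> *\<^sub>H of_real r"
    and qinner_cnj: "qcnj (qinner \<phi> \<psi>) = qinner \<psi> \<phi>"
    and qinner_add_right: "qinner \<phi> (\<psi> + \<xi>) = qinner \<phi> \<psi> + qinner \<phi> \<xi>"
    and qinner_qscale_right: "qinner \<phi> (\<psi> *\<^sub>H q) = qinner \<phi> \<psi> * q"
    and qinner_qscale_left: "qinner (\<phi> *\<^sub>H q) \<psi> = qcnj q * qinner \<phi> \<psi>"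
    and qinner_self: "qinner \<phi> \<phi> = of_real ((norm \<phi>)\<^sup>2)"
    and separable: "\<exists>D. countable D \<and> (\<forall>\<phi> \<epsilon>. 0 < \<epsilon> \<longrightarrow> (\<exists>\<psi>\<in>D. dist \<psi> \<phi> < \<epsilon>))"

text \<open>The class is inhabited, for instance by \<open>\<bbbH>\<close> itself.\<close>

instantiation quat :: right_quat_hilbert
begin

definition qscale_quat :: "quat \<Rightarrow> quat \<Rightarrow> quat"
  where "qscale_quat p q = p * q"

definition qinner_quat :: "quat \<Rightarrow> quat \<Rightarrow> quat"
  where "qinner_quat p q = qcnj p * q"

instance
proof
  fix p q r s :: quat and t :: real
  show "(p + q) *\<^sub>H r = p *\<^sub>H r + q *\<^sub>H r" "p *\<^sub>H (q + r) = p *\<^sub>H q + p *\<^sub>H r"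
    "(p *\<^sub>H q) *\<^sub>H r = p *\<^sub>H (q * r)" "p *\<^sub>H 1 = p"
    by (simp_all add: qscale_quat_def distrib_left distrib_right mult.assoc)
  show "t *\<^sub>R p = p *\<^sub>H of_real t"
    by (simp add: qscale_quat_def quat_eq_iff)
  show "qcnj (qinner p q) = qinner q p" "qinner (p *\<^sub>H q) r = qcnj q * qinner p r"
    by (simp_all add: qscale_quat_def qinner_quat_def quat_eq_iff algebra_simps)
  show "qinner p (q + r) = qinner p q + qinner p r" "qinner p (q *\<^sub>H r) = qinner p q * r"
    by (simp_all add: qscale_quat_def qinner_quat_def distrib_left mult.assoc)
  show "qinner p p = of_real ((norm p)\<^sup>2)"
    by (simp add: qinner_quat_def quat_eq_iff norm_quat_def power2_eq_square del: of_real_power)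
  obtain D :: "quat set" where D: "countable D" "\<And>X. open X \<Longrightarrow> X \<noteq> {} \<Longrightarrow> \<exists>d\<in>D. d \<in> X"
    by (rule countable_dense_setE) blast
  have "\<exists>d\<in>D. dist d x < e" if "0 < e" for x :: quat and e :: real
  proof -
    have "\<exists>d\<in>D. d \<in> ball x e"
      by (rule D(2)) (use that in simp_all)
    then show ?thesis
      by (simp add: dist_commute)
  qed
  then show "\<exists>D :: quat set. countable D \<and> (\<forall>x e. 0 < e \<longrightarrow> (\<exists>d\<in>D. dist d x < e))"
    by (intro exI [of _ D] conjI D(1)) simp
qed

end


section \<open>Bounded right linear operators and the adjoint\<close>

definition right_linear :: "('v::right_quat_hilbert \<Rightarrow> 'v) \<Rightarrow> bool"
  where "right_linear A \<longleftrightarrow>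
    (\<forall>\<phi> \<psi>. A (\<phi> + \<psi>) = A \<phi> + A \<psi>) \<and> (\<forall>\<phi> q. A (\<phi> *\<^sub>H q) = A \<phi> *\<^sub>H q)"

definition bounded_ops :: "('v::right_quat_hilbert \<Rightarrow> 'v) set"
  where "bounded_ops = {A. right_linear A \<and> (\<exists>K. \<forall>\<phi>. norm (A \<phi>) \<le> K * norm \<phi>)}"

text \<open>
  For \<open>A \<in> bounded_ops\<close> there is exactly one such \<open>B\<close>: existence is the Riesz representation
  theorem, uniqueness is non-degeneracy of the inner product.
\<close>

definition adj_op :: "('v::right_quat_hilbert \<Rightarrow> 'v) \<Rightarrow> ('v \<Rightarrow> 'v)"
  where "adj_op A = (THE B. \<forall>\<phi> \<psi>. qinner \<psi> (A \<phi>) = qinner (B \<psi>) \<phi>)"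


section \<open>S-spectra\<close>

definition R_op :: "quat \<Rightarrow> ('v::right_quat_hilbert \<Rightarrow> 'v) \<Rightarrow> ('v \<Rightarrow> 'v)"
  where "R_op q A = (\<lambda>\<phi>. A (A \<phi>) - (2 * qRe q) *\<^sub>R A \<phi> + (norm q)\<^sup>2 *\<^sub>R \<phi>)"

definition S_spectrum :: "('v::right_quat_hilbert \<Rightarrow> 'v) \<Rightarrow> quat set"
  where "S_spectrum A =
    {q. \<not> (\<exists>B\<in>bounded_ops. B \<circ> R_op q A = id \<and> R_op q A \<circ> B = id)}"

definition approx_S_spectrum :: "('v::right_quat_hilbert \<Rightarrow> 'v) \<Rightarrow> quat set"
  where "approx_S_spectrum A =
    {q. \<exists>\<phi> :: nat \<Rightarrow> 'v. (\<forall>n. norm (\<phi> n) = 1) \<and> (\<lambda>n. norm (R_op q A (\<phi> n))) \<longlonglongrightarrow> 0}"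

definition surj_S_spectrum :: "('v::right_quat_hilbert \<Rightarrow> 'v) \<Rightarrow> quat set"
  where "surj_S_spectrum A = {q. range (R_op q A) \<noteq> UNIV}"

definition kato_S_resolvent :: "('v::right_quat_hilbert \<Rightarrow> 'v) \<Rightarrow> quat set"
  where "kato_S_resolvent A =
    {q. closed (range (R_op q A)) \<and>
        {\<phi>. R_op q A \<phi> = 0} \<subseteq> (\<Inter>n. range (R_op q A ^^ n))}"

definition kato_S_spectrum :: "('v::right_quat_hilbert \<Rightarrow> 'v) \<Rightarrow> quat set"
  where "kato_S_spectrum A = - kato_S_resolvent A"


section \<open>Slice-regular functions and the analytic residuum\<close>

definition imaginary_units :: "quat set"
  where "imaginary_units = {I. I * I = - 1}"

definition slice_point :: "quat \<Rightarrow> real \<Rightarrow> real \<Rightarrow> quat"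
  where "slice_point I x y = of_real x + of_real y * I"

text \<open>
  A function on the open set \<open>U\<close> is a total function whose values outside \<open>U\<close> are irrelevant.
  The restriction of \<open>f\<close> to \<open>U \<inter> L\<^sub>I\<close> is viewed as a function of \<open>(x, y)\<close> on the open set \<open>D\<close>;
  \<open>fx\<close> and \<open>fy\<close> are its two partial derivatives.
\<close>

definition right_slice_regular_on ::
    "quat set \<Rightarrow> (quat \<Rightarrow> 'v::right_quat_hilbert) \<Rightarrow> bool"
  where "right_slice_regular_on U f \<longleftrightarrow>
    (\<forall>p\<in>U. f differentiable (at p)) \<and>
    (\<forall>I\<in>imaginary_units. \<exists>fx fy :: real \<times> real \<Rightarrow> 'v.
       let D = {(x, y). slice_point I x y \<in> U} in
         continuous_on D fx \<and> continuous_on D fy \<and>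
         (\<forall>(x, y)\<in>D.
            ((\<lambda>t. f (slice_point I t y)) has_vector_derivative fx (x, y)) (at x) \<and>
            ((\<lambda>t. f (slice_point I x t)) has_vector_derivative fy (x, y)) (at y) \<and>
            fx (x, y) + fy (x, y) *\<^sub>H I = 0))"

definition analytic_residuum :: "('v::right_quat_hilbert \<Rightarrow> 'v) \<Rightarrow> quat set"
  where "analytic_residuum A =
    {q. \<exists>U f. open U \<and> q \<in> U \<and> continuous_on U f \<and> right_slice_regular_on U f \<and>
         (\<forall>p\<in>U. f p \<noteq> 0) \<and> (\<forall>p\<in>U. R_op p A (f p) = 0)}"

end

theory Submission
  imports Defs
begin

text \<open>
  Write \<open>R\<close> for \<open>R_op q A\<close>. By the closed range theorem and duality, \<open>R\<close> is surjective exactly if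
  \<open>R_op q (adj_op A)\<close> is bounded below, and Kato regularity of \<open>R\<close> passes to its adjoint: for a Kato
  regular \<open>R\<close> all powers have closed range, the kernel of every power lies in the range of \<open>R\<close>, and
  taking orthogonal complements turns the latter inclusion into the one required of the adjoint
  (\<open>kato_regular_adjoint\<close>). Operators that are bounded below or surjective are Kato regular. The
  S-spectrum is the union of the approximate point and the surjectivity S-spectrum, and its frontier
  lies in both because an operator that is bounded below stays bounded below, and stays
  surjective or non-surjective, under small perturbations (\<open>frontier_S_spectrum_subset_approx\<close>). The analytic
  residuum is contained in the interior of the S-spectrum, hence disjoint from the frontier.

  All remaining parts of the theorem are Boolean consequences of a single inclusion, applied to \<open>A\<close>
  and to its adjoint: a point \<open>q\<close> at which \<open>R\<close> is Kato regular but not bounded below belongs to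
  the analytic residuum (\<open>kato_approx_subset_analytic_residuum\<close>). Kato regularity gives a kernel
  vector \<open>a\<^sub>0\<close> and, by the open mapping theorem, vectors \<open>a\<^sub>n\<close> with \<open>R a\<^sub>n\<^sub>+\<^sub>1 = a\<^sub>n\<close> and at most
  geometric growth. Let \<open>\<Delta>(p) = p\<^sup>2 - 2 Re(q) p + |q|\<^sup>2\<close>, a real polynomial with \<open>\<Delta>(q) = 0\<close>. Near \<open>q\<close>
  the spherical power series \<open>S(p) = \<Sum>n. a\<^sub>n \<Delta>(p)\<^sup>n\<close> converges and satisfies \<open>R S(p) = S(p) \<Delta>(p)\<close>;
  therefore \<open>f(p) = A S(p) + S(p) (p - 2 Re(q))\<close> satisfies \<open>A f(p) = f(p) p\<close>, and \<open>R_op p A (f p) = 0\<close>.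
  Since \<open>\<Delta>\<close> has real coefficients, \<open>f\<close> is right slice-regular. Finally \<open>f(q) = A a\<^sub>0 - a\<^sub>0 q\<^sup>*\<close>, where
  \<open>q\<^sup>*\<close> is the conjugate of \<open>q\<close>, and Kato regularity allows a choice of \<open>a\<^sub>0\<close> for which this is not zero
  (\<open>R_op_kernel_vector_not_eigenvector\<close>).
\<close>


section \<open>Operators with closed range between Banach spaces\<close>

text \<open>
  The Baire part of the open mapping theorem, carried out inside the complete space \<open>range T\<close>:
  this space is the union of the closures of the images of the balls of integer radius, so one of
  these closures contains a relative ball, and differences of its points are approximate values of
  \<open>T\<close> on vectors of controlled norm.
\<close>

lemma closed_range_approximate_preimages:
  fixes T :: "'a::banach \<Rightarrow> 'b::banach"
  assumes T: "bounded_linear T" and cl: "closed (range T)"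
  obtains M where "0 < M"
    "\<And>y e. y \<in> range T \<Longrightarrow> 0 < e \<Longrightarrow> \<exists>x. norm x \<le> M * norm y \<and> norm (y - T x) < e"
proof -
  interpret T: bounded_linear T by (rule T)
  define Y where "Y = range T"
  define G where "G n = closure (T ` cball 0 (real n))" for n
  have GY: "G n \<subseteq> Y" for n
    unfolding G_def Y_def by (rule closure_minimal) (use cl in auto)
  have YG: "(\<Union>n. G n) = Y"
  proof (rule antisym)
    show "(\<Union>n. G n) \<subseteq> Y" using GY by blast
    show "Y \<subseteq> (\<Union>n. G n)"
    proof
      fix y assume "y \<in> Y"
      then obtain x where x: "y = T x" unfolding Y_def by blast
      obtain n where "norm x \<le> real n" using real_arch_simple by blast
      then have "y \<in> G n" unfolding G_def x by (intro subsetD [OF closure_subset]) auto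
      then show "y \<in> (\<Union>n. G n)" by blast
    qed
  qed
  \<comment> \<open>Baire: a complete nonempty space is no countable union of nowhere dense closed sets.\<close>
  have "\<exists>n. top_of_set Y interior_of G n \<noteq> {}"
  proof (rule ccontr)
    assume empty: "\<not> ?thesis"
    have "top_of_set Y interior_of \<Union>(range G) = {}"
    proof (intro Baire_category_alt disjI1)
      show "completely_metrizable_space (top_of_set Y)"
        using cl by (simp add: Y_def completely_metrizable_space_closedin completely_metrizable_space_euclidean)
      show "closedin (top_of_set Y) Z \<and> top_of_set Y interior_of Z = {}" if "Z \<in> range G" for Z
        using that empty GY by (auto simp: G_def intro!: closed_subset)
    qed auto
    moreover have "\<Union>(range G) = topspace (top_of_set Y)" using YG by simp
    ultimately have "Y = {}" by (simp only: interior_of_topspace) simp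
    then show False by (simp add: Y_def)
  qed
  then obtain n y0 where "y0 \<in> top_of_set Y interior_of G n" by blast
  then obtain W where W: "openin (top_of_set Y) W" "y0 \<in> W" "W \<subseteq> G n"
    by (meson interior_of_subset openin_interior_of)
  then obtain e where e: "0 < e" "ball y0 e \<inter> Y \<subseteq> G n" and y0: "y0 \<in> Y"
    by (metis openin_contains_ball openin_imp_subset subset_iff order_trans inf_commute)
  \<comment> \<open>A ball of radius \<open>e\<close> is approximated by differences of vectors of norm at most \<open>n\<close>; rescaling \<open>y\<close> to
    norm \<open>e / 2\<close> turns this into the factor \<open>4 * n / e\<close>, and \<open>n + 1\<close> keeps it positive.\<close>
  define M where "M = 4 * (real n + 1) / e"
  show thesis
  proof (rule that)
    show "0 < M" using e by (simp add: M_def)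
    fix y :: 'b and d :: real assume y: "y \<in> range T" and d: "0 < d"
    show "\<exists>x. norm x \<le> M * norm y \<and> norm (y - T x) < d"
    proof (cases "y = 0")
      case True
      then show ?thesis using d by (intro exI [of _ 0]) (simp add: T.zero)
    next
      case False
      then have ny: "0 < norm y" by simp
      define s where "s = e / (2 * norm y)"
      have s: "0 < s" using e ny by (simp add: s_def)
      have "y0 + s *\<^sub>R y \<in> Y"
        using y0 y unfolding Y_def by (auto simp flip: T.add T.scaleR)
      moreover have "y0 + s *\<^sub>R y \<in> ball y0 e"
        using e ny by (simp add: dist_norm s_def)
      ultimately have 1: "y0 + s *\<^sub>R y \<in> G n" using e by blast
      have 2: "y0 \<in> G n" using e y0 by auto
      have sd: "0 < s * d / 2" using s d by simp
      obtain a where a: "norm a \<le> real n" "dist (T a) (y0 + s *\<^sub>R y) < s * d / 2"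
        using 1 sd unfolding G_def closure_approachable by fastforce
      obtain b where b: "norm b \<le> real n" "dist (T b) y0 < s * d / 2"
        using 2 sd unfolding G_def closure_approachable by fastforce
      define x where "x = inverse s *\<^sub>R (a - b)"
      have "s * norm (y - T x) = norm (s *\<^sub>R (y - T x))" using s by simp
      also have "s *\<^sub>R (y - T x) = (y0 + s *\<^sub>R y - T a) + (T b - y0)"
        using s by (simp add: x_def T.scaleR T.diff scaleR_right_diff_distrib)
      also have "norm \<dots> < s * d"
        using a b by (intro order.strict_trans1 [OF norm_triangle_ineq]) (simp add: dist_norm norm_minus_commute)
      finally have "norm (y - T x) < d" using s by simp
      moreover have "norm x \<le> M * norm y"
      proof -
        have "norm x = inverse s * norm (a - b)" using s by (simp add: x_def)
        also have "\<dots> \<le> inverse s * (2 * (real n + 1))"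
          using a b s norm_triangle_ineq4 [of a b] by (intro mult_left_mono) auto
        also have "\<dots> = M * norm y" using ny e by (simp add: s_def M_def field_simps)
        finally show ?thesis .
      qed
      ultimately show ?thesis by blast
    qed
  qed
qed

text \<open>
  The open mapping theorem for operators with closed range. Approximate preimages of the
  successive remainders form a geometric series, and its sum is an exact preimage.
\<close>

lemma closed_range_bounded_preimages:
  fixes T :: "'a::banach \<Rightarrow> 'b::banach"
  assumes T: "bounded_linear T" and cl: "closed (range T)"
  obtains C where "0 < C" "\<And>y. y \<in> range T \<Longrightarrow> \<exists>x. T x = y \<and> norm x \<le> C * norm y"
proof -
  interpret T: bounded_linear T by (rule T)
  obtain M where M: "0 < M"
    "\<And>y e. y \<in> range T \<Longrightarrow> 0 < e \<Longrightarrow> \<exists>x. norm x \<le> M * norm y \<and> norm (y - T x) < e"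
    using closed_range_approximate_preimages [OF T cl] by blast
  show thesis
  proof (rule that)
    show "0 < 2 * M" using M by simp
    fix y assume y: "y \<in> range T"
    show "\<exists>x. T x = y \<and> norm x \<le> 2 * M * norm y"
    proof (cases "y = 0")
      case True
      then show ?thesis by (intro exI [of _ 0]) (simp add: T.zero)
    next
      case False
      have "\<exists>x. z \<in> range T \<longrightarrow> norm x \<le> M * norm z \<and> (z \<noteq> 0 \<longrightarrow> norm (z - T x) < norm z / 2)" for z
      proof (cases "z = 0")
        case True
        then show ?thesis by (intro exI [of _ 0]) simp
      next
        case False
        then have "0 < norm z / 2" by simp
        then show ?thesis using M(2) by blast
      qed
      then obtain g where g: "\<And>z. z \<in> range T \<Longrightarrow> norm (g z) \<le> M * norm z"
        "\<And>z. z \<in> range T \<Longrightarrow> z \<noteq> 0 \<Longrightarrow> norm (z - T (g z)) < norm z / 2" by metis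
      have g0: "g 0 = 0" using g(1) [of 0] rangeI [of T 0] by (simp add: T.zero)
      \<comment> \<open>The remainders after each correction; their norms at least halve.\<close>
      define r where "r n = ((\<lambda>z. z - T (g z)) ^^ n) y" for n
      have r_Suc: "r (Suc n) = r n - T (g (r n))" for n by (simp add: r_def)
      have r: "r n \<in> range T \<and> norm (r n) \<le> norm y * (1/2)^n" for n
      proof (induction n)
        case 0 show ?case using y by (simp add: r_def)
      next
        case (Suc n)
        obtain v where "r n = T v" using Suc by blast
        then have "r (Suc n) = T (v - g (r n))" by (simp add: r_Suc T.diff)
        then have "r (Suc n) \<in> range T" by blast
        moreover have "norm (r (Suc n)) \<le> norm (r n) / 2"
          using g(2) [of "r n"] Suc unfolding r_Suc by (cases "r n = 0") (auto simp: g0 T.zero)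
        ultimately show ?case using Suc by auto
      qed
      have gb: "norm (g (r n)) \<le> M * norm y * (1/2)^n" for n
      proof -
        have "norm (g (r n)) \<le> M * norm (r n)" using g(1) r by blast
        also have "\<dots> \<le> M * (norm y * (1/2)^n)" using r M(1) by (intro mult_left_mono) auto
        finally show ?thesis by (simp add: mult.assoc)
      qed
      have geo: "(\<lambda>n. M * norm y * (1/2)^n) sums (M * norm y * 2)"
        using sums_mult [OF geometric_sums [of "1/2::real"], of "M * norm y"] by simp
      have sn: "summable (\<lambda>n. norm (g (r n)))"
        by (rule summable_comparison_test' [OF sums_summable [OF geo], of 0]) (use gb in auto)
      define x where "x = (\<Sum>n. g (r n))"
      have "norm x \<le> M * norm y * 2"
        unfolding x_def using summable_norm [OF sn] suminf_le [OF gb sn sums_summable [OF geo]]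
        by (simp add: sums_unique [OF geo, symmetric])
      moreover have "T x = y"
      proof -
        have "(\<lambda>n. g (r n)) sums x" unfolding x_def
          by (rule summable_sums [OF summable_norm_cancel [OF sn]])
        then have s1: "(\<lambda>n. T (g (r n))) sums T x" by (rule T.sums)
        have "r \<longlonglongrightarrow> 0"
        proof (rule Lim_null_comparison)
          show "\<forall>\<^sub>F n in sequentially. norm (r n) \<le> norm y * (1/2)^n" using r by simp
          show "(\<lambda>n. norm y * (1/2)^n) \<longlonglongrightarrow> 0"
            by (intro tendsto_mult_right_zero LIMSEQ_realpow_zero) auto
        qed
        from telescope_sums' [OF this] have "(\<lambda>n. T (g (r n))) sums (y - 0)"
          by (simp add: r_Suc r_def)
        then show ?thesis using sums_unique2 [OF s1] by simp
      qed
      ultimately show ?thesis by (intro exI [of _ x]) (simp add: mult.assoc mult.commute mult.left_commute)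
    qed
  qed
qed

lemma closed_image_if_bounded_below:
  fixes T :: "'a::banach \<Rightarrow> 'b::real_normed_vector"
  assumes T: "bounded_linear T" and N: "closed N" "subspace N" and c: "0 < c"
    and below: "\<And>x. x \<in> N \<Longrightarrow> c * norm x \<le> norm (T x)"
  shows "closed (T ` N)"
proof -
  have "complete (T ` N)"
  proof (rule complete_isometric_image [OF c N(2) T])
    show "\<forall>x\<in>N. c * norm x \<le> norm (T x)" using below by blast
    show "complete N" using N(1) by (simp add: complete_eq_closed)
  qed
  then show ?thesis by (rule complete_imp_closed)
qed

text \<open>
  If \<open>T (m n)\<close> tends to \<open>T x\<close>, then bounded preimages \<open>u n\<close> of the differences tend to \<open>0\<close>,
  and \<open>x + u n\<close> differs from \<open>m n\<close> by a kernel vector. It thus stays in \<open>M\<close>, and so does its limit \<open>x\<close>.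
\<close>

lemma closed_image_if_kernel_subset:
  fixes T :: "'a::banach \<Rightarrow> 'b::banach"
  assumes T: "bounded_linear T" and cl: "closed (range T)"
    and M: "closed M" "subspace M" and ker: "{x. T x = 0} \<subseteq> M"
  shows "closed (T ` M)"
proof -
  interpret T: bounded_linear T by (rule T)
  obtain C where C: "0 < C" "\<And>y. y \<in> range T \<Longrightarrow> \<exists>x. T x = y \<and> norm x \<le> C * norm y"
    using closed_range_bounded_preimages [OF T cl] by blast
  show ?thesis
  proof (rule closed_sequential_limits [THEN iffD2], intro allI impI, elim conjE)
    fix y l assume y: "\<forall>n. y n \<in> T ` M" and lim: "y \<longlonglongrightarrow> l"
    obtain m where m: "\<And>n. m n \<in> M" "\<And>n. y n = T (m n)" 
    proof -
      have "\<forall>n. \<exists>m. m \<in> M \<and> y n = T m" using y by blast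
      then show thesis using that by metis
    qed
    have "l \<in> range T" using m(2) by (intro closed_sequentially [OF cl _ lim]) simp
    then obtain x where x: "l = T x" by blast
    have "\<exists>u. T u = y n - l \<and> norm u \<le> C * norm (y n - l)" for n
      using C(2) [of "y n - l"] by (simp add: m(2) x flip: T.diff)
    then obtain u where u: "\<And>n. T (u n) = y n - l" "\<And>n. norm (u n) \<le> C * norm (y n - l)" by metis
    have "u \<longlonglongrightarrow> 0"
    proof (rule Lim_null_comparison)
      show "\<forall>\<^sub>F n in sequentially. norm (u n) \<le> C * norm (y n - l)" using u by simp
      show "(\<lambda>n. C * norm (y n - l)) \<longlonglongrightarrow> 0"
        by (intro tendsto_mult_right_zero tendsto_norm_zero LIM_zero lim)
    qed
    then have lim': "(\<lambda>n. x + u n) \<longlonglongrightarrow> x + 0" by (intro tendsto_intros)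
    have "x + u n \<in> M" for n
    proof -
      have "T (m n - (x + u n)) = 0" by (simp add: T.diff T.add u m(2) [symmetric] x)
      then have "m n - (x + u n) \<in> M" using ker by blast
      then have "m n - (m n - (x + u n)) \<in> M" by (rule subspace_diff [OF M(2) m(1)])
      then show ?thesis by (simp add: add.commute)
    qed
    then have "x \<in> M" using closed_sequentially [OF M(1) _ lim'] by simp
    then show "l \<in> T ` M" using x by blast
  qed
qed

lemma subspace_range: "bounded_linear T \<Longrightarrow> subspace (range T)"
  by (simp add: bounded_linear.linear linear_subspace_image)

definition bounded_below :: "('a::real_normed_vector \<Rightarrow> 'b::real_normed_vector) \<Rightarrow> bool"
  where "bounded_below T \<longleftrightarrow> (\<exists>c>0. \<forall>\<phi>. c * norm \<phi> \<le> norm (T \<phi>))"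

lemma bounded_below_kernel: "bounded_below T \<Longrightarrow> T k = 0 \<Longrightarrow> k = 0"
  unfolding bounded_below_def by (metis mult_le_0_iff norm_le_zero_iff norm_zero not_less)

lemma bounded_below_closed_range:
  fixes T :: "'a::banach \<Rightarrow> 'b::banach"
  assumes T: "bounded_linear T" and "bounded_below T"
  shows "closed (range T)"
proof -
  obtain c where "0 < c" "\<And>\<phi>. c * norm \<phi> \<le> norm (T \<phi>)"
    using assms(2) unfolding bounded_below_def by blast
  then show ?thesis using closed_image_if_bounded_below [OF T closed_UNIV subspace_UNIV] by blast
qed


section \<open>Kato regular operators\<close>

text \<open>
  The condition on \<open>R_op q A\<close> by which the Kato S-resolvent set is defined.
\<close>

definition kato_regular :: "('a::real_normed_vector \<Rightarrow> 'a) \<Rightarrow> bool"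
  where "kato_regular T \<longleftrightarrow> closed (range T) \<and> {x. T x = 0} \<subseteq> (\<Inter>n. range (T ^^ n))"

lemma bounded_linear_power:
  fixes T :: "'a::real_normed_vector \<Rightarrow> 'a"
  shows "bounded_linear T \<Longrightarrow> bounded_linear (T ^^ n)"
proof (induction n)
  case 0 show ?case using bounded_linear_ident by (simp add: id_def)
next
  case (Suc n) then show ?case using bounded_linear_compose [of T "T ^^ n"] by (simp add: o_def)
qed

text \<open>
  Induction on \<open>n\<close>: the vector \<open>T x\<close> lies in the kernel of a lower power, hence equals
  \<open>T (T\<^sup>m z)\<close> for some \<open>z\<close>, and \<open>x\<close> differs from \<open>T\<^sup>m z\<close> by a vector in the kernel of \<open>T\<close>.
\<close>

lemma kato_regular_kernel_power_subset_range:
  fixes T :: "'a::real_normed_vector \<Rightarrow> 'a"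
  assumes T: "bounded_linear T" and k: "kato_regular T"
  shows "(T ^^ n) x = 0 \<Longrightarrow> x \<in> range (T ^^ m)"
proof (induction n arbitrary: x m)
  case 0
  interpret Tm: bounded_linear "T ^^ m" by (rule bounded_linear_power [OF T])
  have "x = (T ^^ m) 0" using 0 by (simp add: Tm.zero)
  then show ?case by blast
next
  case (Suc n)
  interpret T: bounded_linear T by (rule T)
  interpret Tm: bounded_linear "T ^^ m" by (rule bounded_linear_power [OF T])
  have "(T ^^ n) (T x) = 0" using Suc.prems by (simp add: funpow_swap1)
  then have "T x \<in> range (T ^^ Suc m)" by (rule Suc.IH)
  then obtain z where z: "T x = T ((T ^^ m) z)" by auto
  then have "T (x - (T ^^ m) z) = 0" by (simp add: T.diff)
  then have "x - (T ^^ m) z \<in> range (T ^^ m)" using k unfolding kato_regular_def by blast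
  then obtain y where "x - (T ^^ m) z = (T ^^ m) y" by blast
  then have "x = (T ^^ m) (y + z)" by (simp add: Tm.add algebra_simps)
  then show ?case by blast
qed

lemma kato_regular_closed_range_power:
  fixes T :: "'a::banach \<Rightarrow> 'a"
  assumes T: "bounded_linear T" and k: "kato_regular T"
  shows "closed (range (T ^^ n))"
proof (induction n)
  case 0 show ?case by simp
next
  case (Suc n)
  have "closed (T ` range (T ^^ n))"
  proof (rule closed_image_if_kernel_subset [OF T])
    show "closed (range T)" using k by (simp add: kato_regular_def)
    show "closed (range (T ^^ n))" by (rule Suc)
    show "subspace (range (T ^^ n))" by (rule subspace_range [OF bounded_linear_power [OF T]])
    show "{x. T x = 0} \<subseteq> range (T ^^ n)" using k unfolding kato_regular_def by blast
  qed
  then show ?case by (simp add: image_comp)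
qed

lemma bounded_below_imp_kato_regular:
  fixes T :: "'a::banach \<Rightarrow> 'a"
  assumes "bounded_linear T" "bounded_below T"
  shows "kato_regular T"
proof -
  have "x \<in> range (T ^^ n)" if "T x = 0" for x n
  proof -
    interpret Tn: bounded_linear "T ^^ n" by (rule bounded_linear_power [OF assms(1)])
    have "x = (T ^^ n) 0" using bounded_below_kernel [OF assms(2) that] by (simp add: Tn.zero)
    then show ?thesis by blast
  qed
  then show ?thesis using bounded_below_closed_range [OF assms] by (auto simp: kato_regular_def)
qed

lemma surj_imp_kato_regular: "range T = UNIV \<Longrightarrow> kato_regular T"
  using surj_fn [of T] by (simp add: kato_regular_def)

text \<open>
  For an injective operator with closed range the preimages of bounded size are the only ones.
\<close>

lemma kato_regular_kernel_nontrivial: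
  fixes T :: "'a::banach \<Rightarrow> 'a"
  assumes T: "bounded_linear T" and k: "kato_regular T" and nb: "\<not> bounded_below T"
  obtains a where "a \<noteq> 0" "T a = 0"
proof (rule ccontr)
  assume "\<not> thesis"
  then have inj: "a = 0" if "T a = 0" for a using that \<open>\<And>a. a \<noteq> 0 \<Longrightarrow> T a = 0 \<Longrightarrow> thesis\<close> by blast
  interpret T: bounded_linear T by (rule T)
  obtain C where C: "0 < C" "\<And>y. y \<in> range T \<Longrightarrow> \<exists>x. T x = y \<and> norm x \<le> C * norm y"
    using closed_range_bounded_preimages [OF T] k unfolding kato_regular_def by blast
  have "inverse C * norm x \<le> norm (T x)" for x
  proof -
    obtain u where u: "T u = T x" "norm u \<le> C * norm (T x)" using C(2) [of "T x"] by blast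
    have "u = x" using inj [of "u - x"] u(1) by (simp add: T.diff)
    then show ?thesis using u(2) C(1) by (simp add: field_simps)
  qed
  then have "bounded_below T" unfolding bounded_below_def using C(1) by (intro exI [of _ "inverse C"]) simp
  then show False using nb by blast
qed

text \<open>
  The coefficients of a local family of kernel vectors. Taking bounded preimages repeatedly never
  gets stuck, because \<open>a n\<close> lies in the kernel of \<open>T ^^ Suc n\<close> and therefore in the range of \<open>T\<close>; the
  geometric bound makes the power series with these coefficients converge.
\<close>

lemma kato_regular_backward_orbit:
  fixes T :: "'a::banach \<Rightarrow> 'a"
  assumes T: "bounded_linear T" and k: "kato_regular T" and a0: "T a0 = 0"
  obtains a C where "a 0 = a0" "\<And>n. T (a (Suc n)) = a n" "0 < C" "\<And>n. norm (a n) \<le> norm a0 * C ^ n"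
proof -
  obtain C where C: "0 < C" "\<And>y. y \<in> range T \<Longrightarrow> \<exists>x. T x = y \<and> norm x \<le> C * norm y"
    using closed_range_bounded_preimages [OF T] k unfolding kato_regular_def by blast
  then obtain g where g: "\<And>y. y \<in> range T \<Longrightarrow> T (g y) = y" "\<And>y. y \<in> range T \<Longrightarrow> norm (g y) \<le> C * norm y"
    by metis
  define a where "a n = (g ^^ n) a0" for n
  have aS: "a (Suc n) = g (a n)" for n by (simp add: a_def)
  have *: "(T ^^ Suc n) (a n) = 0" for n
  proof (induction n)
    case 0 show ?case using a0 by (simp add: a_def)
  next
    case (Suc n)
    have "a n \<in> range T" using kato_regular_kernel_power_subset_range [OF T k Suc, of 1] by simp
    then have "(T ^^ Suc (Suc n)) (a (Suc n)) = (T ^^ Suc n) (a n)" by (simp add: aS g(1) funpow_swap1)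
    then show ?case using Suc by simp
  qed
  have ran: "a n \<in> range T" for n
    using kato_regular_kernel_power_subset_range [OF T k * [of n], of 1] by simp
  show thesis
  proof (rule that [of a C])
    show "a 0 = a0" by (simp add: a_def)
    show "T (a (Suc n)) = a n" for n by (simp add: aS g(1) ran)
    show "norm (a n) \<le> norm a0 * C ^ n" for n
    proof (induction n)
      case (Suc n)
      have "norm (a (Suc n)) \<le> C * norm (a n)" by (simp add: aS g(2) ran)
      also have "\<dots> \<le> C * (norm a0 * C ^ n)" using Suc C(1) by (intro mult_left_mono) auto
      finally show ?case by (simp add: mult_ac)
    qed (simp add: a_def)
  qed (rule C)
qed


section \<open>The underlying real Hilbert space\<close>

text \<open>
  The real inner product that turns \<open>V\<close> into a real Hilbert space with the same norm. Closures, and the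
  orthogonal complements of right subspaces, are already determined by it.
\<close>

definition rinner :: "'v::right_quat_hilbert \<Rightarrow> 'v \<Rightarrow> real"
  where "rinner \<phi> \<psi> = qRe (qinner \<phi> \<psi>)"

lemma rinner_commute: "rinner \<phi> \<psi> = rinner \<psi> \<phi>"
  unfolding rinner_def by (subst qinner_cnj [symmetric]) simp

lemma rinner_self: "rinner \<phi> \<phi> = (norm \<phi>)\<^sup>2"
  by (simp add: rinner_def qinner_self del: of_real_power)

lemma rinner_add_right: "rinner \<phi> (\<psi> + \<xi>) = rinner \<phi> \<psi> + rinner \<phi> \<xi>"
  by (simp add: rinner_def qinner_add_right)

lemma rinner_add_left: "rinner (\<psi> + \<xi>) \<phi> = rinner \<psi> \<phi> + rinner \<xi> \<phi>"
  by (simp add: rinner_commute [of _ \<phi>] rinner_add_right)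

lemma rinner_scaleR_right: "rinner \<phi> (r *\<^sub>R \<psi>) = r * rinner \<phi> \<psi>"
  by (simp add: rinner_def scaleR_eq_qscale qinner_qscale_right)

lemma rinner_scaleR_left: "rinner (r *\<^sub>R \<psi>) \<phi> = r * rinner \<psi> \<phi>"
  by (simp add: rinner_commute [of _ \<phi>] rinner_scaleR_right)

lemma norm_add_sq: "(norm (\<phi> + \<psi>))\<^sup>2 = (norm \<phi>)\<^sup>2 + 2 * rinner \<phi> \<psi> + (norm (\<psi>::'v::right_quat_hilbert))\<^sup>2"
  using rinner_commute [of \<phi> \<psi>] by (simp add: rinner_add_left rinner_add_right flip: rinner_self)

lemma rinner_Cauchy_Schwarz: "\<bar>rinner \<phi> \<psi>\<bar> \<le> norm \<phi> * norm (\<psi>::'v::right_quat_hilbert)"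
proof -
  have *: "rinner \<phi> \<psi> \<le> norm \<phi> * norm \<psi>" for \<phi> \<psi> :: 'v
  proof -
    have "(norm (\<phi> + \<psi>))\<^sup>2 \<le> (norm \<phi> + norm \<psi>)\<^sup>2"
      by (intro power_mono norm_triangle_ineq) simp
    then show ?thesis by (simp add: norm_add_sq power2_sum)
  qed
  from * [of \<phi> \<psi>] * [of "(-1) *\<^sub>R \<phi>" \<psi>] show ?thesis
    by (simp only: rinner_scaleR_left) simp
qed

lemma bounded_bilinear_rinner: "bounded_bilinear (rinner :: 'v::right_quat_hilbert \<Rightarrow> _)"
  by standard (auto simp: rinner_add_left rinner_add_right rinner_scaleR_left rinner_scaleR_right
      intro!: exI [of _ 1] rinner_Cauchy_Schwarz)

interpretation rinner: bounded_bilinear "rinner :: 'v::right_quat_hilbert \<Rightarrow> 'v \<Rightarrow> real"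
  by (rule bounded_bilinear_rinner)

lemma rinner_eqI: "(\<And>\<phi>. rinner x \<phi> = rinner y \<phi>) \<Longrightarrow> x = y"
  using rinner_self [of "x - y"] by (simp add: rinner.diff_left)

lemma parallelogram: "(norm (x + y))\<^sup>2 + (norm (x - y))\<^sup>2 = 2 * (norm x)\<^sup>2 + 2 * (norm (y::'v::right_quat_hilbert))\<^sup>2"
  using norm_add_sq [of x y] norm_add_sq [of x "-y"] by (simp add: rinner.minus_right)

text \<open>
  A minimising sequence for the distance from \<open>x\<close> to \<open>M\<close> is a Cauchy sequence by the
  parallelogram law, and at its limit the derivative of the squared distance in any direction of \<open>M\<close>
  vanishes.
\<close>

lemma orthogonal_projection:
  fixes M :: "'v::right_quat_hilbert set"
  assumes M: "closed M" "subspace M"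
  obtains m where "m \<in> M" "\<And>u. u \<in> M \<Longrightarrow> rinner (x - m) u = 0"
proof -
  define d where "d = (INF m\<in>M. (norm (x - m))\<^sup>2)"
  have ne: "M \<noteq> {}" using subspace_0 [OF M(2)] by blast
  have bdd: "bdd_below ((\<lambda>m. (norm (x - m))\<^sup>2) ` M)" by (intro bdd_belowI [of _ 0]) auto
  have d: "d \<le> (norm (x - m))\<^sup>2" if "m \<in> M" for m
    unfolding d_def by (rule cINF_lower [OF bdd that])
  have "\<exists>m\<in>M. (norm (x - m))\<^sup>2 < d + inverse (real (Suc n))" for n
  proof -
    have "d < d + inverse (real (Suc n))" by simp
    then show ?thesis unfolding d_def using cINF_less_iff [OF ne bdd] by blast
  qed
  then obtain m where m: "\<And>n. m n \<in> M" "\<And>n. (norm (x - m n))\<^sup>2 < d + inverse (real (Suc n))"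
    by metis
  \<comment> \<open>The midpoint of two almost minimal points is no closer to \<open>x\<close> than \<open>sqrt d\<close>, so by the
    parallelogram law the two points are close to each other.\<close>
  have diff: "(norm (m i - m j))\<^sup>2 \<le> 2 * inverse (real (Suc i)) + 2 * inverse (real (Suc j))" for i j
  proof -
    have "(1/2) *\<^sub>R (m i + m j) \<in> M" using m(1) M(2) by (simp add: subspace_add subspace_scale)
    from d [OF this] have "4 * d \<le> 4 * (norm (x - (1/2) *\<^sub>R (m i + m j)))\<^sup>2" by simp
    also have "\<dots> = (norm (2 *\<^sub>R (x - (1/2) *\<^sub>R (m i + m j))))\<^sup>2" by (simp add: power_mult_distrib)
    also have "2 *\<^sub>R (x - (1/2) *\<^sub>R (m i + m j)) = (x - m i) + (x - m j)"
      by (simp add: algebra_simps scaleR_2)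
    finally have "4 * d \<le> (norm ((x - m i) + (x - m j)))\<^sup>2" .
    with parallelogram [of "x - m i" "x - m j"] m(2) [of i] m(2) [of j] show ?thesis
      by (simp add: norm_minus_commute)
  qed
  have "Cauchy m"
  proof (rule metric_CauchyI)
    fix e :: real assume e: "0 < e"
    then have "0 < e\<^sup>2 / 4" by simp
    then obtain N where N: "inverse (real (Suc N)) < e\<^sup>2 / 4" using reals_Archimedean by blast
    have "dist (m i) (m j) < e" if "i \<ge> N" "j \<ge> N" for i j
    proof -
      have "inverse (real (Suc i)) \<le> inverse (real (Suc N))" "inverse (real (Suc j)) \<le> inverse (real (Suc N))"
        using that by (auto intro!: le_imp_inverse_le)
      then have "(norm (m i - m j))\<^sup>2 < e\<^sup>2" using diff [of i j] N by linarith
      then show ?thesis using e by (simp add: dist_norm power_less_imp_less_base)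
    qed
    then show "\<exists>N. \<forall>i\<ge>N. \<forall>j\<ge>N. dist (m i) (m j) < e" by blast
  qed
  then obtain l where l: "m \<longlonglongrightarrow> l" using Cauchy_convergent convergent_def by blast
  have lM: "l \<in> M" by (rule closed_sequentially [OF M(1) m(1) l])
  have "(norm (x - l))\<^sup>2 \<le> d + 0"
  proof (rule LIMSEQ_le)
    show "(\<lambda>n. (norm (x - m n))\<^sup>2) \<longlonglongrightarrow> (norm (x - l))\<^sup>2" by (intro tendsto_intros l)
    show "(\<lambda>n. d + inverse (real (Suc n))) \<longlonglongrightarrow> d + 0"
      by (intro tendsto_intros LIMSEQ_inverse_real_of_nat)
    show "\<exists>N. \<forall>n\<ge>N. (norm (x - m n))\<^sup>2 \<le> d + inverse (real (Suc n))"
      using m(2) less_imp_le by blast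
  qed
  then have min: "(norm (x - l))\<^sup>2 \<le> (norm (x - u))\<^sup>2" if "u \<in> M" for u
    using d [OF that] by linarith
  show thesis
  proof (rule that [OF lM])
    fix u assume u: "u \<in> M"
    show "rinner (x - l) u = 0"
    proof (cases "u = 0")
      case True then show ?thesis by (simp add: rinner.zero_right)
    next
      case False
      define c where "c = rinner (x - l) u"
      \<comment> \<open>The step along \<open>u\<close> that would decrease the distance most.\<close>
      define t where "t = c / (norm u)\<^sup>2"
      have nu: "(norm u)\<^sup>2 > 0" using False by simp
      have "(norm (x - l))\<^sup>2 \<le> (norm (x - (l + t *\<^sub>R u)))\<^sup>2"
        using u lM M(2) by (intro min) (simp add: subspace_add subspace_scale)
      also have "x - (l + t *\<^sub>R u) = (x - l) + (-t) *\<^sub>R u" by simp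
      also have "(norm \<dots>)\<^sup>2 = (norm (x - l))\<^sup>2 - 2 * t * c + t\<^sup>2 * (norm u)\<^sup>2"
        by (subst norm_add_sq) (simp add: rinner.minus_right rinner_scaleR_right c_def power_mult_distrib)
      also have "t\<^sup>2 * (norm u)\<^sup>2 = t * c" using nu by (simp add: t_def power2_eq_square)
      finally have "t * c \<le> 0" by (simp add: mult.commute)
      then have "c\<^sup>2 \<le> 0" using nu by (simp add: t_def power2_eq_square divide_le_0_iff)
      then show ?thesis by (simp add: c_def)
    qed
  qed
qed

lemma closed_subspace_separation:
  fixes M :: "'v::right_quat_hilbert set"
  assumes M: "closed M" "subspace M" and x: "x \<notin> M"
  obtains w where "\<And>u. u \<in> M \<Longrightarrow> rinner w u = 0" "rinner w x \<noteq> 0"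
proof -
  obtain m where m: "m \<in> M" "\<And>u. u \<in> M \<Longrightarrow> rinner (x - m) u = 0"
    using orthogonal_projection [OF M] by blast
  have "rinner (x - m) x = rinner (x - m) (x - m)" using m by (simp add: rinner.diff_right)
  also have "\<dots> \<noteq> 0" using m(1) x by (auto simp: rinner_self)
  finally show thesis using that m by blast
qed

text \<open>
  A vector orthogonal to the kernel represents the functional up to a factor.
\<close>

lemma riesz_representation:
  fixes l :: "'v::right_quat_hilbert \<Rightarrow> real"
  assumes l: "bounded_linear l"
  obtains w where "\<And>\<phi>. l \<phi> = rinner w \<phi>"
proof (cases "\<forall>\<phi>. l \<phi> = 0")
  case True
  then show thesis using that [of 0] by (simp add: rinner.zero_left)
next
  case False
  interpret l: bounded_linear l by (rule l)
  from False obtain x where x: "l x \<noteq> 0" by blast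
  have "closed {\<phi>. l \<phi> = 0}"
    by (intro closed_Collect_eq continuous_intros l.continuous_on)
  moreover have "subspace {\<phi>. l \<phi> = 0}"
    by (auto simp: subspace_def l.zero l.add l.scaleR)
  moreover have "x \<notin> {\<phi>. l \<phi> = 0}" using x by simp
  ultimately obtain w where "\<And>u. u \<in> {\<phi>. l \<phi> = 0} \<Longrightarrow> rinner w u = 0" and w2: "rinner w x \<noteq> 0"
    by (rule closed_subspace_separation) blast
  then have w: "rinner w u = 0" if "l u = 0" for u using that by simp
  show thesis
  proof (rule that)
    fix \<phi>
    have "l (\<phi> - (l \<phi> / l x) *\<^sub>R x) = 0" using x by (simp add: l.diff l.scaleR)
    from w [OF this] have "rinner w \<phi> = l \<phi> / l x * rinner w x"
      by (simp add: rinner.diff_right rinner_scaleR_right)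
    then show "l \<phi> = rinner ((l x / rinner w x) *\<^sub>R w) \<phi>"
      using x w2 by (simp add: rinner_scaleR_left)
  qed
qed

text \<open>
  A nonzero vector \<open>w = T u\<close> orthogonal to the closed range of \<open>S\<close> would satisfy
  \<open>norm w \<le> k * norm u < c * norm u \<le> norm w\<close>.
\<close>

lemma surj_perturbation:
  fixes T S :: "'v::right_quat_hilbert \<Rightarrow> 'v"
  assumes S: "bounded_linear S"
    and c: "\<And>\<phi>. c * norm \<phi> \<le> norm (T \<phi>)" and k: "\<And>\<phi>. norm (T \<phi> - S \<phi>) \<le> k * norm \<phi>" "k < c"
    and surj: "range T = UNIV"
  shows "range S = UNIV"
proof (rule ccontr)
  assume "range S \<noteq> UNIV"
  then obtain x where x: "x \<notin> range S" by blast
  have "(c - k) * norm \<phi> \<le> norm (S \<phi>)" for \<phi>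
  proof -
    have "norm (T \<phi>) \<le> norm (T \<phi> - S \<phi>) + norm (S \<phi>)" using norm_triangle_ineq [of "T \<phi> - S \<phi>" "S \<phi>"] by simp
    then show ?thesis using c [of \<phi>] k(1) [of \<phi>] by (simp add: left_diff_distrib)
  qed
  then have cl: "closed (range S)"
    using closed_image_if_bounded_below [OF S closed_UNIV subspace_UNIV, of "c - k"] k(2) by simp
  obtain w where w: "\<And>u. u \<in> range S \<Longrightarrow> rinner w u = 0" "rinner w x \<noteq> 0"
    using closed_subspace_separation [OF cl subspace_range [OF S] x] by blast
  obtain u where u: "T u = w" using surj by (metis surjD)
  have w0: "w \<noteq> 0" using w(2) by (auto simp: rinner.zero_left)
  have u0: "u \<noteq> 0"
  proof
    assume "u = 0"
    then have "norm (T u - S u) \<le> 0" using k(1) [of u] by simp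
    then have "w = S u" using u by simp
    then have "rinner w w = 0" using w(1) by blast
    then show False using w0 by (simp add: rinner_self)
  qed
  \<comment> \<open>Since \<open>w\<close> is orthogonal to \<open>S u\<close>, its norm is controlled by the perturbation alone.\<close>
  have "norm w * norm w = rinner w (T u - S u)"
    using w(1) [of "S u"] by (simp add: u rinner.diff_right rinner_self power2_eq_square)
  also have "\<dots> \<le> norm w * norm (T u - S u)" using rinner_Cauchy_Schwarz [of w "T u - S u"] by simp
  finally have "norm w \<le> norm (T u - S u)" using w0 by simp
  also have "\<dots> \<le> k * norm u" by (rule k)
  also have "\<dots> < c * norm u" using k(2) u0 by simp
  also have "\<dots> \<le> norm w" using c [of u] u by simp
  finally show False by simp
qed


section \<open>Duality between an operator and its adjoint\<close>

text \<open>
  Adjointness for the real inner product, as a relation: it is symmetric, which lets every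
  duality statement be read in both directions.
\<close>

definition adjoint_pair :: "('v::right_quat_hilbert \<Rightarrow> 'v) \<Rightarrow> ('v \<Rightarrow> 'v) \<Rightarrow> bool"
  where "adjoint_pair T S \<longleftrightarrow> (\<forall>\<phi> \<psi>. rinner \<psi> (T \<phi>) = rinner (S \<psi>) \<phi>)"

lemma adjoint_pairD: "adjoint_pair T S \<Longrightarrow> rinner \<psi> (T \<phi>) = rinner (S \<psi>) \<phi>"
  by (simp add: adjoint_pair_def)

lemma adjoint_pair_sym: "adjoint_pair T S \<Longrightarrow> adjoint_pair S T"
  by (simp add: adjoint_pair_def rinner_commute [of _ "T _"] rinner_commute [of _ "S _"])

lemma adjoint_pair_compose:
  "adjoint_pair T S \<Longrightarrow> adjoint_pair T' S' \<Longrightarrow> adjoint_pair (T \<circ> T') (S' \<circ> S)"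
  by (simp add: adjoint_pair_def)

lemma adjoint_pair_power: "adjoint_pair T S \<Longrightarrow> adjoint_pair (T ^^ n) (S ^^ n)"
proof (induction n)
  case 0 then show ?case by (simp add: adjoint_pair_def)
next
  case (Suc n)
  then have "adjoint_pair (T ^^ n \<circ> T) (S \<circ> S ^^ n)" by (simp add: adjoint_pair_compose)
  then show ?case by (subst funpow_Suc_right) simp
qed

lemma kernel_adjoint_iff: "adjoint_pair T S \<Longrightarrow> S \<psi> = 0 \<longleftrightarrow> (\<forall>\<phi>. rinner \<psi> (T \<phi>) = 0)"
  using rinner_eqI [of "S \<psi>" 0] by (auto simp: adjoint_pairD rinner.zero_left)

text \<open>
  For \<open>\<psi> = T x\<close> with \<open>x\<close> of bounded size, the square of the norm of \<open>\<psi>\<close> is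
  \<open>rinner \<psi> (T x) = rinner (S \<psi>) x\<close>.
\<close>

lemma adjoint_bounded_below_on_closed_range:
  fixes T S :: "'v::right_quat_hilbert \<Rightarrow> 'v"
  assumes T: "bounded_linear T" and ad: "adjoint_pair T S" and cl: "closed (range T)"
  obtains c where "0 < c" "\<And>\<psi>. \<psi> \<in> range T \<Longrightarrow> c * norm \<psi> \<le> norm (S \<psi>)"
proof -
  obtain C where C: "0 < C" "\<And>y. y \<in> range T \<Longrightarrow> \<exists>x. T x = y \<and> norm x \<le> C * norm y"
    using closed_range_bounded_preimages [OF T cl] by blast
  show thesis
  proof (rule that)
    show "0 < inverse C" using C by simp
    fix \<psi> assume "\<psi> \<in> range T"
    then obtain x where x: "T x = \<psi>" "norm x \<le> C * norm \<psi>" using C by blast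
    have "norm \<psi> * norm \<psi> = rinner (S \<psi>) x"
      using adjoint_pairD [OF ad, of \<psi> x] by (simp add: x rinner_self power2_eq_square)
    also have "\<dots> \<le> norm (S \<psi>) * norm x" using rinner_Cauchy_Schwarz [of "S \<psi>" x] by simp
    also have "\<dots> \<le> norm (S \<psi>) * (C * norm \<psi>)" by (intro mult_left_mono x) simp
    finally have "norm \<psi> * norm \<psi> \<le> (C * norm (S \<psi>)) * norm \<psi>" by (simp add: mult_ac)
    then have "norm \<psi> \<le> C * norm (S \<psi>)"
      by (cases "\<psi> = 0") (use C in auto)
    then show "inverse C * norm \<psi> \<le> norm (S \<psi>)" using C by (simp add: field_simps)
  qed
qed

text \<open>
  The orthogonal complement of \<open>range T\<close> is the kernel of \<open>S\<close>, so \<open>S\<close> has the same range as its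
  restriction to \<open>range T\<close>, and this restriction is bounded below.
\<close>

lemma closed_range_adjoint:
  fixes T S :: "'v::right_quat_hilbert \<Rightarrow> 'v"
  assumes T: "bounded_linear T" and S: "bounded_linear S" and ad: "adjoint_pair T S"
    and cl: "closed (range T)"
  shows "closed (range S)"
proof -
  interpret S: bounded_linear S by (rule S)
  obtain c where c: "0 < c" "\<And>\<psi>. \<psi> \<in> range T \<Longrightarrow> c * norm \<psi> \<le> norm (S \<psi>)"
    using adjoint_bounded_below_on_closed_range [OF T ad cl] by blast
  have "range S \<subseteq> S ` range T"
  proof
    fix y assume "y \<in> range S"
    then obtain \<psi> where \<psi>: "y = S \<psi>" by blast
    obtain m where m: "m \<in> range T" "\<And>u. u \<in> range T \<Longrightarrow> rinner (\<psi> - m) u = 0"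
      using orthogonal_projection [OF cl subspace_range [OF T]] by blast
    have "S (\<psi> - m) = 0" by (subst kernel_adjoint_iff [OF ad]) (simp add: m(2))
    then have "y = S m" by (simp add: \<psi> S.diff)
    then show "y \<in> S ` range T" using m(1) by blast
  qed
  then have "range S = S ` range T" by blast
  then show ?thesis
    using closed_image_if_bounded_below [OF S cl subspace_range [OF T] c] by simp
qed

text \<open>
  A vector outside the closed range of \<open>S\<close> is not orthogonal to some \<open>w\<close> that is orthogonal to
  this range, and such a \<open>w\<close> lies in the kernel of \<open>T\<close>.
\<close>

lemma range_adjoint_iff:
  fixes T S :: "'v::right_quat_hilbert \<Rightarrow> 'v"
  assumes S: "bounded_linear S" and ad: "adjoint_pair T S" and cl: "closed (range S)"
  shows "x \<in> range S \<longleftrightarrow> (\<forall>k. T k = 0 \<longrightarrow> rinner x k = 0)"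
proof
  assume "x \<in> range S"
  then show "\<forall>k. T k = 0 \<longrightarrow> rinner x k = 0"
    using adjoint_pairD [OF adjoint_pair_sym [OF ad]] 
    by (auto simp: rinner_commute [of x] rinner.zero_left)
next
  assume *: "\<forall>k. T k = 0 \<longrightarrow> rinner x k = 0"
  show "x \<in> range S"
  proof (rule ccontr)
    assume "x \<notin> range S"
    then obtain w where w: "\<And>u. u \<in> range S \<Longrightarrow> rinner w u = 0" "rinner w x \<noteq> 0"
      using closed_subspace_separation [OF cl subspace_range [OF S]] by blast
    have "T w = 0" by (subst kernel_adjoint_iff [OF adjoint_pair_sym [OF ad]]) (simp add: w(1))
    then have "rinner x w = 0" using * by blast
    then show False using w(2) by (simp add: rinner_commute [of w])
  qed
qed

lemma surj_adjoint_if_bounded_below: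
  fixes T S :: "'v::right_quat_hilbert \<Rightarrow> 'v"
  assumes T: "bounded_linear T" and S: "bounded_linear S" and ad: "adjoint_pair T S"
    and c: "0 < c" "\<And>\<phi>. c * norm \<phi> \<le> norm (T \<phi>)"
  shows "range S = UNIV"
proof -
  have "closed (range T)"
    using closed_image_if_bounded_below [OF T closed_UNIV subspace_UNIV c(1)] c(2) by simp
  then have cl: "closed (range S)" by (rule closed_range_adjoint [OF T S ad])
  have "rinner x k = 0" if "T k = 0" for x k
    using c(2) [of k] c(1) that by (simp add: mult_le_0_iff rinner.zero_right)
  then have "x \<in> range S" for x
    by (intro range_adjoint_iff [OF S ad cl, THEN iffD2]) blast
  then show ?thesis by blast
qed

lemma adjoint_bounded_below_if_surj:
  fixes T S :: "'v::right_quat_hilbert \<Rightarrow> 'v"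
  assumes T: "bounded_linear T" and ad: "adjoint_pair T S" and surj: "range T = UNIV"
  obtains c where "0 < c" "\<And>\<phi>. c * norm \<phi> \<le> norm (S \<phi>)"
proof -
  have "closed (range T)" by (simp add: surj)
  then obtain c where "0 < c" "\<And>\<psi>. \<psi> \<in> range T \<Longrightarrow> c * norm \<psi> \<le> norm (S \<psi>)"
    using adjoint_bounded_below_on_closed_range [OF T ad] by blast
  then show thesis using that [of c] by (simp add: surj)
qed

lemma range_eq_UNIV_iff_bounded_below_adjoint:
  fixes T S :: "'v::right_quat_hilbert \<Rightarrow> 'v"
  assumes T: "bounded_linear T" and S: "bounded_linear S" and ad: "adjoint_pair T S"
  shows "range T = UNIV \<longleftrightarrow> bounded_below S"
proof
  assume "range T = UNIV"
  then obtain c where "0 < c" "\<And>\<phi>. c * norm \<phi> \<le> norm (S \<phi>)"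
    by (rule adjoint_bounded_below_if_surj [OF T ad]) blast
  then show "bounded_below S" unfolding bounded_below_def by blast
next
  assume "bounded_below S"
  then obtain c where "0 < c" "\<And>\<phi>. c * norm \<phi> \<le> norm (S \<phi>)" unfolding bounded_below_def by blast
  then show "range T = UNIV"
    by (rule surj_adjoint_if_bounded_below [OF S T adjoint_pair_sym [OF ad]])
qed

lemma kato_regular_adjoint:
  fixes T S :: "'v::right_quat_hilbert \<Rightarrow> 'v"
  assumes T: "bounded_linear T" and S: "bounded_linear S" and ad: "adjoint_pair T S"
    and k: "kato_regular T"
  shows "kato_regular S"
  unfolding kato_regular_def
proof (intro conjI subsetI INT_I)
  show "closed (range S)"
    using closed_range_adjoint [OF T S ad] k by (simp add: kato_regular_def)
  fix x n assume "x \<in> {x. S x = 0}"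
  then have x: "rinner x (T \<phi>) = 0" for \<phi> using kernel_adjoint_iff [OF ad, of x] by simp
  note Sn = bounded_linear_power [OF S, of n] and Tn = bounded_linear_power [OF T, of n]
    and adn = adjoint_pair_power [OF ad, of n]
  \<comment> \<open>The kernel of \<open>S\<close> is orthogonal to \<open>range T\<close>, hence to the smaller space \<open>ker (T ^^ n)\<close>, whose
    orthogonal complement is the closed space \<open>range (S ^^ n)\<close>.\<close>
  have "closed (range (S ^^ n))"
    by (rule closed_range_adjoint [OF Tn Sn adn kato_regular_closed_range_power [OF T k]])
  moreover have "rinner x u = 0" if "(T ^^ n) u = 0" for u
    using kato_regular_kernel_power_subset_range [OF T k that, of 1] x by auto
  ultimately show "x \<in> range (S ^^ n)"
    by (intro range_adjoint_iff [OF Sn adn, THEN iffD2]) blast+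
qed


section \<open>Bounded right linear operators\<close>

lemma bounded_opsD:
  assumes "A \<in> bounded_ops"
  shows "bounded_linear A" "A (\<phi> *\<^sub>H q) = A \<phi> *\<^sub>H q"
proof -
  show q: "A (\<phi> *\<^sub>H q) = A \<phi> *\<^sub>H q" for \<phi> q using assms by (simp add: bounded_ops_def right_linear_def)
  obtain K where "\<And>\<phi>. norm (A \<phi>) \<le> K * norm \<phi>" using assms by (auto simp: bounded_ops_def)
  then show "bounded_linear A" using assms
    by (intro bounded_linear_intro [of A K])
      (auto simp: bounded_ops_def right_linear_def scaleR_eq_qscale mult.commute)
qed

lemma bounded_opsI:
  assumes "bounded_linear A" "\<And>\<phi> q. A (\<phi> *\<^sub>H q) = A \<phi> *\<^sub>H q"
  shows "A \<in> bounded_ops"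
proof -
  obtain K where "\<And>\<phi>. norm (A \<phi>) \<le> norm \<phi> * K" using bounded_linear.bounded [OF assms(1)] by blast
  then show ?thesis using assms
    by (auto simp: bounded_ops_def right_linear_def linear_add bounded_linear.linear mult.commute)
qed

lemma norm_qscale: "norm (x *\<^sub>H q) = norm (x::'v::right_quat_hilbert) * norm q"
proof -
  have "(of_real ((norm (x *\<^sub>H q))\<^sup>2) :: quat) = qcnj q * of_real ((norm x)\<^sup>2) * q"
    by (simp add: qinner_qscale_left qinner_qscale_right mult.assoc flip: qinner_self del: of_real_power)
  then have "(norm (x *\<^sub>H q))\<^sup>2 = qRe (qcnj q * of_real ((norm x)\<^sup>2) * q)"
    by (metis quat_of_real_simps(1))
  also have "\<dots> = (norm x * norm q)\<^sup>2"
    by (simp add: norm_quat_def power_mult_distrib power2_eq_square algebra_simps del: of_real_power of_real_mult)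
  finally show ?thesis by (simp add: power2_eq_iff_nonneg)
qed

lemma bounded_bilinear_qscale:
  "bounded_bilinear (qscale :: 'v::right_quat_hilbert \<Rightarrow> quat \<Rightarrow> 'v)"
proof
  fix x y :: 'v and p q :: quat and r :: real
  show "(x + y) *\<^sub>H q = x *\<^sub>H q + y *\<^sub>H q" by (rule qscale_add_left)
  show "x *\<^sub>H (p + q) = x *\<^sub>H p + x *\<^sub>H q" by (rule qscale_add_right)
  have *: "of_real r * q = q * of_real r" "r *\<^sub>R q = q * of_real r" by (simp_all add: quat_eq_iff)
  show "(r *\<^sub>R x) *\<^sub>H q = r *\<^sub>R (x *\<^sub>H q)" by (simp add: scaleR_eq_qscale qscale_qscale *)
  show "x *\<^sub>H (r *\<^sub>R q) = r *\<^sub>R (x *\<^sub>H q)"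
    by (simp only: *(2)) (simp add: scaleR_eq_qscale qscale_qscale)
  show "\<exists>K. \<forall>(x::'v) q. norm (x *\<^sub>H q) \<le> norm x * norm q * K"
    by (intro exI [of _ 1]) (simp add: norm_qscale)
qed

interpretation qscale: bounded_bilinear "qscale :: 'v::right_quat_hilbert \<Rightarrow> quat \<Rightarrow> 'v"
  by (rule bounded_bilinear_qscale)

lemma qscale_eq_0_iff: "\<phi> *\<^sub>H q = 0 \<longleftrightarrow> \<phi> = 0 \<or> q = 0" for \<phi> :: "'v::right_quat_hilbert"
proof -
  have "norm (\<phi> *\<^sub>H q) = 0 \<longleftrightarrow> norm \<phi> = 0 \<or> norm q = 0" by (simp only: norm_qscale mult_eq_0_iff)
  then show ?thesis by simp
qed

lemma R_op_bounded_ops: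
  assumes "A \<in> bounded_ops"
  shows "R_op q A \<in> bounded_ops"
proof (rule bounded_opsI)
  note A = bounded_opsD [OF assms]
  show "bounded_linear (R_op q A)" unfolding R_op_def
    by (intro bounded_linear_intros bounded_linear_compose [OF A(1)] A(1))
  show "R_op q A (\<phi> *\<^sub>H p) = R_op q A \<phi> *\<^sub>H p" for \<phi> p
    by (simp add: R_op_def A(2) qscale.add_left qscale.diff_left qscale.scaleR_left)
qed

lemmas R_op_bounded_linear = bounded_opsD(1) [OF R_op_bounded_ops]

lemma quat_eq_if_qRe_mult_eq:
  assumes "\<And>u. qRe (p * u) = qRe (q * u)"
  shows "p = q"
  using assms [of 1] assms [of "Quat 0 1 0 0"] assms [of "Quat 0 0 1 0"] assms [of "Quat 0 0 0 1"]
  by (simp add: quat_eq_iff)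

lemma qinner_eqI: "(\<And>\<phi>. qinner x \<phi> = qinner y \<phi>) \<Longrightarrow> x = y"
  by (rule rinner_eqI) (simp add: rinner_def)

text \<open>
  The Riesz theorem produces an adjoint for the real inner product; right linearity of \<open>A\<close>
  lifts the adjunction to the quaternionic inner product, and right linearity and boundedness of the
  adjoint follow from it.
\<close>

lemma adjoint_exists:
  fixes A :: "'v::right_quat_hilbert \<Rightarrow> 'v"
  assumes "A \<in> bounded_ops"
  shows "\<exists>B\<in>bounded_ops. \<forall>\<phi> \<psi>. qinner \<psi> (A \<phi>) = qinner (B \<psi>) \<phi>"
proof -
  note A = bounded_opsD [OF assms]
  have "\<exists>w. \<forall>\<phi>. rinner \<psi> (A \<phi>) = rinner w \<phi>" for \<psi>
  proof -
    have "bounded_linear (\<lambda>\<phi>. rinner \<psi> (A \<phi>))"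
      by (rule bounded_linear_compose [OF rinner.bounded_linear_right A(1)])
    then show ?thesis by (rule riesz_representation) blast
  qed
  then obtain B where B: "\<And>\<phi> \<psi>. rinner \<psi> (A \<phi>) = rinner (B \<psi>) \<phi>" by metis
  \<comment> \<open>Testing the real identity on \<open>\<phi> *\<^sub>H u\<close> recovers all components of the quaternionic one.\<close>
  have Bq: "qinner \<psi> (A \<phi>) = qinner (B \<psi>) \<phi>" for \<phi> \<psi>
  proof (rule quat_eq_if_qRe_mult_eq)
    fix u
    show "qRe (qinner \<psi> (A \<phi>) * u) = qRe (qinner (B \<psi>) \<phi> * u)"
      using B [of \<psi> "\<phi> *\<^sub>H u"] by (simp only: rinner_def qinner_qscale_right A(2))
  qed
  have add: "B (x + y) = B x + B y" for x y
    by (rule rinner_eqI) (simp add: rinner.add_left flip: B)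
  have q: "B (x *\<^sub>H q) = B x *\<^sub>H q" for x q
    by (rule qinner_eqI) (simp add: qinner_qscale_left flip: Bq)
  obtain K where K: "\<And>\<phi>. norm (A \<phi>) \<le> norm \<phi> * K" using bounded_linear.bounded [OF A(1)] by blast
  have "norm (B x) \<le> norm x * K" for x
  proof -
    have "norm (B x) * norm (B x) = rinner x (A (B x))" by (simp add: B rinner_self power2_eq_square)
    also have "\<dots> \<le> norm x * norm (A (B x))" using rinner_Cauchy_Schwarz [of x "A (B x)"] by simp
    also have "\<dots> \<le> norm x * (norm (B x) * K)" by (intro mult_left_mono K) simp
    also have "\<dots> = (norm x * K) * norm (B x)" by simp
    finally have *: "norm (B x) * norm (B x) \<le> (norm x * K) * norm (B x)" .
    show "norm (B x) \<le> norm x * K"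
    proof (cases "B x = 0")
      case True
      have "0 \<le> norm x * K" using K [of x] norm_ge_zero [of "A x"] by linarith
      then show ?thesis using True by simp
    next
      case False
      then show ?thesis using * by simp
    qed
  qed
  then have "bounded_linear B"
    by (intro bounded_linear_intro [of B K]) (auto simp: add q scaleR_eq_qscale)
  then have "B \<in> bounded_ops" by (rule bounded_opsI) (rule q)
  then show ?thesis by (rule bexI [rotated]) (simp add: Bq)
qed

lemma adj_op_eqI:
  fixes A B :: "'v::right_quat_hilbert \<Rightarrow> 'v"
  assumes "\<And>\<phi> \<psi>. qinner \<psi> (A \<phi>) = qinner (B \<psi>) \<phi>"
  shows "adj_op A = B"
  unfolding adj_op_def
proof (rule the_equality)
  fix C assume C: "\<forall>\<phi> \<psi>. qinner \<psi> (A \<phi>) = qinner (C \<psi>) \<phi>"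
  show "C = B"
  proof (rule ext, rule qinner_eqI)
    fix x y
    show "qinner (C x) y = qinner (B x) y" using C assms [of x y] by simp
  qed
qed (simp add: assms)

lemma adj_op_props:
  fixes A :: "'v::right_quat_hilbert \<Rightarrow> 'v"
  assumes "A \<in> bounded_ops"
  shows "adj_op A \<in> bounded_ops" "adjoint_pair A (adj_op A)" "adj_op (adj_op A) = A"
proof -
  obtain B where B: "B \<in> bounded_ops" "\<And>\<phi> \<psi>. qinner \<psi> (A \<phi>) = qinner (B \<psi>) \<phi>"
    using adjoint_exists [OF assms] by blast
  have eq: "adj_op A = B" by (rule adj_op_eqI) (rule B)
  show "adj_op A \<in> bounded_ops" using B eq by simp
  show "adjoint_pair A (adj_op A)" unfolding eq adjoint_pair_def rinner_def by (simp add: B(2))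
  have "qinner \<psi> (B \<phi>) = qinner (A \<psi>) \<phi>" for \<phi> \<psi>
    using arg_cong [OF B(2) [of \<phi> \<psi>], of qcnj] by (simp add: qinner_cnj)
  then show "adj_op (adj_op A) = A" unfolding eq by (rule adj_op_eqI)
qed

lemma R_op_adjoint_pair: "adjoint_pair A B \<Longrightarrow> adjoint_pair (R_op q A) (R_op q B)"
  by (simp add: adjoint_pair_def R_op_def rinner.add_left rinner.add_right rinner.diff_left
      rinner.diff_right rinner_scaleR_left rinner_scaleR_right)


section \<open>The S-spectra of an operator and of its adjoint\<close>

lemma kato_S_resolvent_eq: "kato_S_resolvent A = {q. kato_regular (R_op q A)}"
  by (simp add: kato_S_resolvent_def kato_regular_def)

lemma kato_S_resolvent_adj_subset:
  assumes "A \<in> bounded_ops"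
  shows "kato_S_resolvent A \<subseteq> kato_S_resolvent (adj_op A)"
proof
  fix q assume "q \<in> kato_S_resolvent A"
  then have "kato_regular (R_op q A)" by (simp add: kato_S_resolvent_eq)
  then have "kato_regular (R_op q (adj_op A))"
    by (rule kato_regular_adjoint [OF R_op_bounded_linear [OF assms]
          R_op_bounded_linear [OF adj_op_props(1) [OF assms]]
          R_op_adjoint_pair [OF adj_op_props(2) [OF assms]]])
  then show "q \<in> kato_S_resolvent (adj_op A)" by (simp add: kato_S_resolvent_eq)
qed

lemma approx_S_spectrum_eq:
  assumes "A \<in> bounded_ops"
  shows "approx_S_spectrum A = {q. \<not> bounded_below (R_op q A)}"
proof (intro set_eqI iffI; unfold mem_Collect_eq)
  fix q assume "q \<in> approx_S_spectrum A"
  then obtain \<phi> where \<phi>: "\<And>n. norm (\<phi> n) = 1" "(\<lambda>n. norm (R_op q A (\<phi> n))) \<longlonglongrightarrow> 0"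
    unfolding approx_S_spectrum_def by blast
  show "\<not> bounded_below (R_op q A)"
  proof
    assume "bounded_below (R_op q A)"
    then obtain c where c: "0 < c" "\<And>\<phi>. c * norm \<phi> \<le> norm (R_op q A \<phi>)" unfolding bounded_below_def by blast
    have "c \<le> norm (R_op q A (\<phi> n))" for n using c(2) [of "\<phi> n"] \<phi>(1) by simp
    then have "c \<le> 0" by (intro LIMSEQ_le_const [OF \<phi>(2)]) blast
    then show False using c by simp
  qed
next
  fix q assume nb: "\<not> bounded_below (R_op q A)"
  interpret T: bounded_linear "R_op q A" by (rule R_op_bounded_linear [OF assms])
  have "\<exists>\<phi>. norm \<phi> = 1 \<and> norm (R_op q A \<phi>) \<le> inverse (real (Suc n))" for n
  proof -
    have "0 < inverse (real (Suc n))" by simp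
    then obtain x where x: "norm (R_op q A x) < inverse (real (Suc n)) * norm x"
      using nb unfolding bounded_below_def by (meson not_le)
    have "x \<noteq> 0" using x by (auto simp: T.zero)
    then show ?thesis using x
      by (intro exI [of _ "inverse (norm x) *\<^sub>R x"]) (simp add: T.scaleR field_simps)
  qed
  then obtain \<phi> where \<phi>: "\<And>n. norm (\<phi> n) = 1" "\<And>n. norm (R_op q A (\<phi> n)) \<le> inverse (real (Suc n))" by metis
  have "(\<lambda>n. norm (R_op q A (\<phi> n))) \<longlonglongrightarrow> 0"
    by (rule Lim_null_comparison [OF _ LIMSEQ_inverse_real_of_nat]) (use \<phi>(2) in simp)
  then show "q \<in> approx_S_spectrum A" unfolding approx_S_spectrum_def using \<phi>(1) by blast
qed

text \<open>
  This duality halves the work: every statement about surjectivity for \<open>A\<close> is one about lower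
  bounds for the adjoint.
\<close>

lemma surj_S_spectrum_eq_approx_adj:
  assumes "A \<in> bounded_ops"
  shows "surj_S_spectrum A = approx_S_spectrum (adj_op A)"
proof -
  have "range (R_op q A) = UNIV \<longleftrightarrow> bounded_below (R_op q (adj_op A))" for q
    by (rule range_eq_UNIV_iff_bounded_below_adjoint [OF R_op_bounded_linear [OF assms]
          R_op_bounded_linear [OF adj_op_props(1) [OF assms]]
          R_op_adjoint_pair [OF adj_op_props(2) [OF assms]]])
  then show ?thesis
    by (simp add: surj_S_spectrum_def approx_S_spectrum_eq adj_op_props(1) [OF assms])
qed

text \<open>
  The inverse of a surjective operator that is bounded below is automatically bounded and right
  linear, so invertibility in the algebra of bounded operators splits into these two conditions.
\<close>

lemma S_spectrum_eq:
  fixes A :: "'v::right_quat_hilbert \<Rightarrow> 'v"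
  assumes "A \<in> bounded_ops"
  shows "S_spectrum A = approx_S_spectrum A \<union> surj_S_spectrum A"
proof -
  have "(\<exists>B\<in>bounded_ops. B \<circ> T = id \<and> T \<circ> B = id) \<longleftrightarrow> bounded_below T \<and> range T = UNIV"
    if T: "T \<in> bounded_ops" for T :: "'v \<Rightarrow> 'v"
  proof
    assume "\<exists>B\<in>bounded_ops. B \<circ> T = id \<and> T \<circ> B = id"
    then obtain B where B: "B \<in> bounded_ops" "\<And>x. B (T x) = x" "\<And>x. T (B x) = x"
      by (metis comp_apply id_apply)
    obtain K where K: "0 < K" "\<And>x. norm (B x) \<le> norm x * K"
      using bounded_linear.pos_bounded [OF bounded_opsD(1) [OF B(1)]] by blast
    have "inverse K * norm x \<le> norm (T x)" for x using K(2) [of "T x"] K(1) by (simp add: B(2) field_simps)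
    then have "bounded_below T" unfolding bounded_below_def using K(1) by (intro exI [of _ "inverse K"]) simp
    moreover have "range T = UNIV" using B(3) by (metis surjI)
    ultimately show "bounded_below T \<and> range T = UNIV" by blast
  next
    assume "bounded_below T \<and> range T = UNIV"
    then obtain c where c: "0 < c" "\<And>x. c * norm x \<le> norm (T x)" and surj: "range T = UNIV"
      and bb: "bounded_below T"
      unfolding bounded_below_def by blast
    interpret T: bounded_linear T by (rule bounded_opsD [OF T])
    have inj: "x = y" if "T x = T y" for x y
      using bounded_below_kernel [OF bb, of "x - y"] that by (simp add: T.diff)
    obtain B where B: "\<And>x. T (B x) = x" using surj by (metis surjD)
    have BT: "B (T x) = x" for x by (rule inj) (rule B)
    have "bounded_linear B"
    proof (rule bounded_linear_intro [where K = "inverse c"])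
      show "B (x + y) = B x + B y" for x y by (rule inj) (simp add: T.add B)
      show "B (r *\<^sub>R x) = r *\<^sub>R B x" for r x by (rule inj) (simp add: T.scaleR B)
      show "norm (B x) \<le> norm x * inverse c" for x using c(2) [of "B x"] c(1) by (simp add: B field_simps)
    qed
    moreover have "B (x *\<^sub>H q) = B x *\<^sub>H q" for x q by (rule inj) (simp add: bounded_opsD(2) [OF T] B)
    ultimately have "B \<in> bounded_ops" by (rule bounded_opsI)
    then show "\<exists>B\<in>bounded_ops. B \<circ> T = id \<and> T \<circ> B = id"
      by (rule bexI [rotated]) (auto simp: fun_eq_iff B BT)
  qed
  then show ?thesis
    by (auto simp: S_spectrum_def approx_S_spectrum_eq [OF assms] surj_S_spectrum_def R_op_bounded_ops [OF assms])
qed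

lemma S_spectrum_adj_op:
  assumes "A \<in> bounded_ops"
  shows "S_spectrum (adj_op A) = S_spectrum A"
  using S_spectrum_eq [OF assms] S_spectrum_eq [OF adj_op_props(1) [OF assms]]
    surj_S_spectrum_eq_approx_adj [OF assms] surj_S_spectrum_eq_approx_adj [OF adj_op_props(1) [OF assms]]
    adj_op_props(3) [OF assms] by auto

lemma bounded_linear_qRe: "bounded_linear qRe"
  by (rule bounded_linear_intro [where K = 1])
    (auto simp: norm_quat_def intro!: real_le_rsqrt)

lemma R_op_close:
  assumes "A \<in> bounded_ops" "0 < e"
  obtains d where "0 < d" "\<And>p \<phi>. dist p q < d \<Longrightarrow> norm (R_op p A \<phi> - R_op q A \<phi>) \<le> e * norm \<phi>"
proof -
  obtain K where K: "0 < K" "\<And>x. norm (A x) \<le> norm x * K"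
    using bounded_linear.pos_bounded [OF bounded_opsD(1) [OF assms(1)]] by blast
  define h where "h p = 2 * \<bar>qRe p - qRe q\<bar> * K + \<bar>(norm p)\<^sup>2 - (norm q)\<^sup>2\<bar>" for p
  have "isCont h q" unfolding h_def
    by (intro continuous_intros bounded_linear.isCont [OF bounded_linear_qRe])
  moreover have "h q = 0" by (simp add: h_def)
  ultimately obtain d where d: "0 < d" "\<And>p. dist p q < d \<Longrightarrow> \<bar>h p\<bar> < e"
    using assms(2) unfolding continuous_at_eps_delta by (auto simp: dist_norm)
  show thesis
  proof (rule that [OF d(1)])
    fix p \<phi> assume p: "dist p q < d"
    have "R_op p A \<phi> - R_op q A \<phi> = ((norm p)\<^sup>2 - (norm q)\<^sup>2) *\<^sub>R \<phi> - (2 * (qRe p - qRe q)) *\<^sub>R A \<phi>"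
      by (simp add: R_op_def algebra_simps)
    also have "norm \<dots> \<le> \<bar>(norm p)\<^sup>2 - (norm q)\<^sup>2\<bar> * norm \<phi> + 2 * \<bar>qRe p - qRe q\<bar> * norm (A \<phi>)"
      by (rule order_trans [OF norm_triangle_ineq4]) (simp only: norm_scaleR abs_mult abs_numeral order_refl)
    also have "\<dots> \<le> \<bar>(norm p)\<^sup>2 - (norm q)\<^sup>2\<bar> * norm \<phi> + 2 * \<bar>qRe p - qRe q\<bar> * (norm \<phi> * K)"
      by (intro add_left_mono mult_left_mono K) simp
    also have "\<dots> = h p * norm \<phi>" by (simp add: h_def algebra_simps)
    also have "\<dots> \<le> e * norm \<phi>" using d(2) [OF p] by (intro mult_right_mono) auto
    finally show "norm (R_op p A \<phi> - R_op q A \<phi>) \<le> e * norm \<phi>" .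
  qed
qed

text \<open>
  If \<open>R_op q A\<close> is bounded below, then so is \<open>R_op p A\<close> for all \<open>p\<close> in some ball around \<open>q\<close>, with
  a common constant. Surjectivity then holds at all points of the ball or at none, so the ball is
  disjoint from the S-spectrum or contained in it.
\<close>

lemma frontier_S_spectrum_subset_approx:
  fixes A :: "'v::right_quat_hilbert \<Rightarrow> 'v"
  assumes A: "A \<in> bounded_ops"
  shows "frontier (S_spectrum A) \<subseteq> approx_S_spectrum A"
proof (rule ccontr)
  assume "\<not> ?thesis"
  then obtain q where q: "q \<in> frontier (S_spectrum A)" "bounded_below (R_op q A)"
    by (auto simp: approx_S_spectrum_eq [OF A])
  then obtain c where c: "0 < c" "\<And>x. c * norm x \<le> norm (R_op q A x)" unfolding bounded_below_def by blast
  have "0 < c / 3" using c by simp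
  then obtain d where d: "0 < d" "\<And>p \<phi>. dist p q < d \<Longrightarrow> norm (R_op p A \<phi> - R_op q A \<phi>) \<le> c / 3 * norm \<phi>"
    using R_op_close [OF A] by blast
  have lin: "bounded_linear (R_op p A)" for p by (rule R_op_bounded_linear [OF A])
  \<comment> \<open>A common lower bound holds on the whole ball, so passing from one point of the ball to \<open>q\<close>
    and on to any other one keeps surjectivity.\<close>
  have below: "c * (2/3) * norm \<phi> \<le> norm (R_op p A \<phi>)" if "dist p q < d" for p \<phi>
    using d(2) [OF that, of \<phi>] c(2) [of \<phi>] norm_triangle_ineq [of "R_op p A \<phi>" "R_op q A \<phi> - R_op p A \<phi>"]
    by (simp add: norm_minus_commute)
  have surj: "range (R_op p' A) = UNIV"
    if p: "dist p q < d" and p': "dist p' q < d" and s: "range (R_op p A) = UNIV" for p p'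
  proof -
    have "range (R_op q A) = UNIV"
      by (rule surj_perturbation [OF lin below [OF p] d(2) [OF p] _ s]) (use c in simp)
    moreover have "norm (R_op q A \<phi> - R_op p' A \<phi>) \<le> c / 3 * norm \<phi>" for \<phi>
      using d(2) [OF p', of \<phi>] by (simp add: norm_minus_commute)
    ultimately show ?thesis
      using surj_perturbation [OF lin c(2), of p' "c / 3"] c(1) by simp
  qed
  have sp: "p \<in> S_spectrum A \<longleftrightarrow> range (R_op p A) \<noteq> UNIV" if "dist p q < d" for p
  proof -
    have "bounded_below (R_op p A)" unfolding bounded_below_def
      using below [OF that] c(1) by (intro exI [of _ "c * (2/3)"]) simp
    then show ?thesis by (simp add: S_spectrum_eq [OF A] approx_S_spectrum_eq [OF A] surj_S_spectrum_def)
  qed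
  obtain p p' where "dist p q < d" "p \<in> S_spectrum A" "dist p' q < d" "p' \<notin> S_spectrum A"
    using q(1) d(1) unfolding frontier_straddle by (metis dist_commute)
  then show False using surj sp by metis
qed

lemma analytic_residuum_subset_interior:
  assumes A: "A \<in> bounded_ops"
  shows "analytic_residuum A \<subseteq> interior (S_spectrum A)"
proof
  fix q assume "q \<in> analytic_residuum A"
  then obtain U f where U: "open U" "q \<in> U" "\<And>p. p \<in> U \<Longrightarrow> f p \<noteq> 0 \<and> R_op p A (f p) = 0"
    unfolding analytic_residuum_def by blast
  have "U \<subseteq> S_spectrum A"
    using U(3) bounded_below_kernel by (fastforce simp: S_spectrum_eq [OF A] approx_S_spectrum_eq [OF A])
  then show "q \<in> interior (S_spectrum A)" using U by (meson interiorI)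
qed


section \<open>Slice derivatives\<close>

text \<open>
  The directions that commute with \<open>p = x + y I\<close> include \<open>1\<close> and \<open>I\<close>. On them the Frechet derivative
  of a right slice-regular function is right multiplication of a single vector \<open>g p\<close>, which is the
  partial derivative in \<open>x\<close>. Asking for this in all commuting directions makes the notion stable
  under sums, bounded operators, multiplication by real polynomials and composition with them.
\<close>

definition has_slice_derivative_on ::
    "quat set \<Rightarrow> (quat \<Rightarrow> 'v::right_quat_hilbert) \<Rightarrow> (quat \<Rightarrow> 'v) \<Rightarrow> bool"
  where "has_slice_derivative_on U f g \<longleftrightarrow> continuous_on U g \<and>
    (\<forall>p\<in>U. \<exists>D. (f has_derivative D) (at p) \<and> (\<forall>h. p * h = h * p \<longrightarrow> D h = g p *\<^sub>H h))"

lemma has_slice_derivative_on_continuous: "has_slice_derivative_on U f g \<Longrightarrow> continuous_on U f"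
  unfolding has_slice_derivative_on_def
  by (meson continuous_at_imp_continuous_on has_derivative_continuous)

text \<open>
  The partial derivatives in \<open>x\<close> and \<open>y\<close> are \<open>g p\<close> and \<open>g p *\<^sub>H I\<close>, and \<open>I * I = - 1\<close>.
\<close>

lemma has_slice_derivative_on_slice_regular:
  assumes f: "has_slice_derivative_on U f g"
  shows "right_slice_regular_on U f"
  unfolding right_slice_regular_on_def
proof (intro conjI ballI)
  fix p assume "p \<in> U"
  then show "f differentiable at p"
    using f unfolding has_slice_derivative_on_def differentiable_def by blast
next
  fix I assume "I \<in> imaginary_units"
  then have I: "I * I = - 1" by (simp add: imaginary_units_def)
  define s where "s = (\<lambda>(x, y). slice_point I x y)"
  define D where "D = {(x, y). slice_point I x y \<in> U}"
  have D: "D = s -` U" by (auto simp: D_def s_def)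
  have g: "continuous_on U g" using f by (simp add: has_slice_derivative_on_def)
  have s: "continuous_on D s" unfolding s_def slice_point_def case_prod_beta by (intro continuous_intros)
  have c: "continuous_on D (\<lambda>z. g (s z))"
    by (rule continuous_on_compose2 [OF g s]) (auto simp: D)
  have der: "((\<lambda>t. f (slice_point I t y)) has_vector_derivative g (slice_point I x y)) (at x) \<and>
      ((\<lambda>t. f (slice_point I x t)) has_vector_derivative g (slice_point I x y) *\<^sub>H I) (at y)"
    if xy: "slice_point I x y \<in> U" for x y
  proof -
    define p where "p = slice_point I x y"
    obtain E where E: "(f has_derivative E) (at p)" "\<And>h. p * h = h * p \<Longrightarrow> E h = g p *\<^sub>H h"
      using f xy unfolding has_slice_derivative_on_def p_def by blast
    have lin: "linear E" using E(1) by (simp add: bounded_linear.linear has_derivative_bounded_linear)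
    have pI: "p * I = I * p"
      by (simp add: p_def slice_point_def distrib_left distrib_right mult.assoc)
        (simp add: quat_eq_iff algebra_simps)
    have "((\<lambda>t. slice_point I t y) has_derivative (\<lambda>t. t *\<^sub>R 1)) (at x)"
      unfolding slice_point_def of_real_def by (auto intro!: derivative_eq_intros)
    from diff_chain_at [OF this, of f E] E(1)
    have 1: "((\<lambda>t. f (slice_point I t y)) has_derivative (\<lambda>t. E (t *\<^sub>R 1))) (at x)"
      by (simp add: o_def p_def)
    have "((\<lambda>t. slice_point I x t) has_derivative (\<lambda>t. t *\<^sub>R I)) (at y)"
      unfolding slice_point_def of_real_def by (auto intro!: derivative_eq_intros)
    from diff_chain_at [OF this, of f E] E(1)
    have 2: "((\<lambda>t. f (slice_point I x t)) has_derivative (\<lambda>t. E (t *\<^sub>R I))) (at y)"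
      by (simp add: o_def p_def)
    show ?thesis using 1 2 E(2) [of 1] E(2) [of I] pI
      by (simp add: has_vector_derivative_def linear_scale [OF lin] qscale_one p_def)
  qed
  show "\<exists>fx fy. let D = {(x, y). slice_point I x y \<in> U} in
         continuous_on D fx \<and> continuous_on D fy \<and>
         (\<forall>(x, y)\<in>D.
            ((\<lambda>t. f (slice_point I t y)) has_vector_derivative fx (x, y)) (at x) \<and>
            ((\<lambda>t. f (slice_point I x t)) has_vector_derivative fy (x, y)) (at y) \<and>
            fx (x, y) + fy (x, y) *\<^sub>H I = 0)"
    unfolding Let_def D_def [symmetric]
  proof (rule exI [of _ "\<lambda>z. g (s z)"], rule exI [of _ "\<lambda>z. g (s z) *\<^sub>H I"], intro conjI c)
    show "continuous_on D (\<lambda>z. g (s z) *\<^sub>H I)"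
      by (rule qscale.continuous_on [OF c continuous_on_const])
    show "\<forall>(x, y)\<in>D.
            ((\<lambda>t. f (slice_point I t y)) has_vector_derivative g (s (x, y))) (at x) \<and>
            ((\<lambda>t. f (slice_point I x t)) has_vector_derivative g (s (x, y)) *\<^sub>H I) (at y) \<and>
            g (s (x, y)) + g (s (x, y)) *\<^sub>H I *\<^sub>H I = 0"
      using der by (auto simp: D_def s_def qscale_qscale I qscale.minus_right qscale_one)
  qed
qed

lemma has_slice_derivative_on_bounded_op:
  assumes A: "A \<in> bounded_ops" and f: "has_slice_derivative_on U f g"
  shows "has_slice_derivative_on U (\<lambda>p. A (f p)) (\<lambda>p. A (g p))"
  unfolding has_slice_derivative_on_def
proof (intro conjI ballI)
  interpret A: bounded_linear A by (rule bounded_opsD [OF A])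
  show "continuous_on U (\<lambda>p. A (g p))"
    using f unfolding has_slice_derivative_on_def by (intro A.continuous_on) blast
  fix p assume "p \<in> U"
  then obtain D where D: "(f has_derivative D) (at p)" "\<And>h. p * h = h * p \<Longrightarrow> D h = g p *\<^sub>H h"
    using f unfolding has_slice_derivative_on_def by blast
  show "\<exists>D. ((\<lambda>p. A (f p)) has_derivative D) (at p) \<and> (\<forall>h. p * h = h * p \<longrightarrow> D h = A (g p) *\<^sub>H h)"
    by (intro exI [of _ "\<lambda>h. A (D h)"] conjI A.has_derivative D) (simp add: D(2) bounded_opsD(2) [OF A])
qed

lemma has_slice_derivative_on_add:
  assumes f: "has_slice_derivative_on U f f'" and g: "has_slice_derivative_on U g g'"
  shows "has_slice_derivative_on U (\<lambda>p. f p + g p) (\<lambda>p. f' p + g' p)"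
  unfolding has_slice_derivative_on_def
proof (intro conjI ballI)
  show "continuous_on U (\<lambda>p. f' p + g' p)"
    using f g unfolding has_slice_derivative_on_def by (intro continuous_intros) blast+
  fix p assume p: "p \<in> U"
  obtain D where D: "(f has_derivative D) (at p)" "\<And>h. p * h = h * p \<Longrightarrow> D h = f' p *\<^sub>H h"
    using f p unfolding has_slice_derivative_on_def by blast
  obtain E where E: "(g has_derivative E) (at p)" "\<And>h. p * h = h * p \<Longrightarrow> E h = g' p *\<^sub>H h"
    using g p unfolding has_slice_derivative_on_def by blast
  show "\<exists>D. ((\<lambda>p. f p + g p) has_derivative D) (at p) \<and> (\<forall>h. p * h = h * p \<longrightarrow> D h = (f' p + g' p) *\<^sub>H h)"
    by (intro exI [of _ "\<lambda>h. D h + E h"] conjI has_derivative_add D E) (simp add: D(2) E(2) qscale_add_left)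
qed

text \<open>
  Because \<open>c\<close> is real, the factor commutes with every direction that commutes with \<open>p\<close>.
\<close>

lemma has_slice_derivative_on_times_linear:
  assumes f: "has_slice_derivative_on U f g"
  shows "has_slice_derivative_on U (\<lambda>p. f p *\<^sub>H (p - of_real c)) (\<lambda>p. f p + g p *\<^sub>H (p - of_real c))"
  unfolding has_slice_derivative_on_def
proof (intro conjI ballI)
  show "continuous_on U (\<lambda>p. f p + g p *\<^sub>H (p - of_real c))"
    using f has_slice_derivative_on_continuous [OF f] unfolding has_slice_derivative_on_def
    by (intro continuous_intros qscale.continuous_on) blast+
  fix p assume p: "p \<in> U"
  obtain D where D: "(f has_derivative D) (at p)" "\<And>h. p * h = h * p \<Longrightarrow> D h = g p *\<^sub>H h"
    using f p unfolding has_slice_derivative_on_def by blast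
  have "((\<lambda>p. f p *\<^sub>H (p - of_real c)) has_derivative (\<lambda>h. f p *\<^sub>H (h - 0) + D h *\<^sub>H (p - of_real c))) (at p)"
    by (intro qscale.FDERIV D derivative_intros)
  moreover have "f p *\<^sub>H (h - 0) + D h *\<^sub>H (p - of_real c) = (f p + g p *\<^sub>H (p - of_real c)) *\<^sub>H h"
    if "p * h = h * p" for h
  proof -
    have "h * (p - of_real c) = (p - of_real c) * h" using that by (simp add: quat_eq_iff algebra_simps)
    then show ?thesis by (simp add: D(2) [OF that] qscale_add_left qscale_qscale)
  qed
  ultimately show "\<exists>D. ((\<lambda>p. f p *\<^sub>H (p - of_real c)) has_derivative D) (at p) \<and>
      (\<forall>h. p * h = h * p \<longrightarrow> D h = (f p + g p *\<^sub>H (p - of_real c)) *\<^sub>H h)" by blast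
qed

text \<open>
  The characteristic polynomial of \<open>q\<close>, evaluated at \<open>p\<close>: the scalar counterpart of \<open>R_op q\<close>. Its
  coefficients are real, and it vanishes at \<open>q\<close>, so its powers are slice-regular replacements for
  the powers of \<open>p - q\<close>, of which the higher ones are not slice-regular for a non-real \<open>q\<close>.
\<close>

definition qchar_poly :: "quat \<Rightarrow> quat \<Rightarrow> quat"
  where "qchar_poly q p = p * p - (2 * qRe q) *\<^sub>R p + of_real ((norm q)\<^sup>2)"

lemma qchar_poly_self: "qchar_poly q q = 0"
  by (simp add: qchar_poly_def quat_eq_iff norm_quat_def power2_eq_square del: of_real_power of_real_mult)

lemma continuous_on_qchar_poly: "continuous_on S (qchar_poly q)"
  unfolding qchar_poly_def by (intro continuous_intros)

lemma has_slice_derivative_on_compose_qchar_poly: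
  assumes f: "has_slice_derivative_on W f g" and U: "qchar_poly q ` U \<subseteq> W"
  shows "has_slice_derivative_on U (\<lambda>p. f (qchar_poly q p)) (\<lambda>p. g (qchar_poly q p) *\<^sub>H (2 *\<^sub>R p - of_real (2 * qRe q)))"
  unfolding has_slice_derivative_on_def
proof (intro conjI ballI)
  have "continuous_on W g" using f by (simp add: has_slice_derivative_on_def)
  then have "continuous_on U (\<lambda>p. g (qchar_poly q p))"
    by (rule continuous_on_compose2 [OF _ continuous_on_qchar_poly U])
  then show "continuous_on U (\<lambda>p. g (qchar_poly q p) *\<^sub>H (2 *\<^sub>R p - of_real (2 * qRe q)))"
    by (intro qscale.continuous_on continuous_intros)
  fix p assume p: "p \<in> U"
  define z where "z = qchar_poly q p"
  obtain D where D: "(f has_derivative D) (at z)" "\<And>h. z * h = h * z \<Longrightarrow> D h = g z *\<^sub>H h"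
    using f p U unfolding has_slice_derivative_on_def z_def by blast
  let ?E = "\<lambda>h. p * h + h * p - (2 * qRe q) *\<^sub>R h + 0"
  have "(qchar_poly q has_derivative ?E) (at p)"
    unfolding qchar_poly_def [abs_def] by (intro derivative_intros)
  from diff_chain_at [OF this, of f D] D(1)
  have "((\<lambda>p. f (qchar_poly q p)) has_derivative (\<lambda>h. D (?E h))) (at p)" by (simp add: o_def z_def)
  moreover have "D (?E h) = g z *\<^sub>H (2 *\<^sub>R p - of_real (2 * qRe q)) *\<^sub>H h" if ph: "p * h = h * p" for h
  proof -
    \<comment> \<open>The inner derivative again commutes with \<open>z\<close>, so the outer slice derivative applies to it.\<close>
    have eq: "?E h = (2 *\<^sub>R p - of_real (2 * qRe q)) * h"
      using ph by (simp add: quat_eq_iff algebra_simps del: of_real_mult)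
    have "p * p * h = h * (p * p)" by (metis ph mult.assoc)
    then have zh: "z * h = h * z" using ph unfolding z_def qchar_poly_def
      by (simp add: distrib_left distrib_right left_diff_distrib right_diff_distrib of_real_def)
    have zp: "z * p = p * z" unfolding z_def qchar_poly_def
      by (simp add: distrib_left distrib_right left_diff_distrib right_diff_distrib of_real_def mult.assoc)
    have "z * ?E h = ?E h * z" unfolding eq
      by (simp add: left_diff_distrib right_diff_distrib of_real_def mult.assoc)
        (metis zh zp mult.assoc)
    then show ?thesis by (subst D(2)) (simp_all only: eq qscale_qscale)
  qed
  ultimately show "\<exists>D. ((\<lambda>p. f (qchar_poly q p)) has_derivative D) (at p) \<and>
      (\<forall>h. p * h = h * p \<longrightarrow> D h = g (qchar_poly q p) *\<^sub>H (2 *\<^sub>R p - of_real (2 * qRe q)) *\<^sub>H h)"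
    unfolding z_def by blast
qed


section \<open>Power series with vector coefficients on the left\<close>

text \<open>
  The sum of \<open>z ^ i * h * z ^ (n - 1 - i)\<close> over \<open>i < n\<close>, built up by the product rule because \<open>z\<close>
  and \<open>h\<close> need not commute.
\<close>

primrec qpow_derivative :: "nat \<Rightarrow> quat \<Rightarrow> quat \<Rightarrow> quat" where
  "qpow_derivative 0 z h = 0"
| "qpow_derivative (Suc n) z h = z * qpow_derivative n z h + h * z ^ n"

lemma has_derivative_qpow: "((\<lambda>z. z ^ n) has_derivative qpow_derivative n z) (at z within S)"
proof (induction n)
  case 0 show ?case by (simp add: has_derivative_const)
next
  case (Suc n)
  have "((\<lambda>z. z * z ^ n) has_derivative (\<lambda>h. z * qpow_derivative n z h + h * z ^ n)) (at z within S)"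
    by (intro has_derivative_mult has_derivative_ident Suc)
  then show ?case by simp
qed

lemma norm_qpow_derivative: "norm (qpow_derivative n z h) \<le> real n * norm z ^ (n - 1) * norm h"
proof (induction n)
  case (Suc n)
  have "norm (qpow_derivative (Suc n) z h) \<le> norm z * norm (qpow_derivative n z h) + norm h * norm z ^ n"
    by (simp add: norm_mult norm_power order_trans [OF norm_triangle_ineq])
  also have "\<dots> \<le> norm z * (real n * norm z ^ (n - 1) * norm h) + norm h * norm z ^ n"
    by (intro add_right_mono mult_left_mono Suc) simp
  also have "\<dots> = real (Suc n) * norm z ^ (Suc n - 1) * norm h"
    by (cases n) (simp_all add: algebra_simps)
  finally show ?case .
qed simp

lemma qpow_derivative_commuting:
  "z * h = h * z \<Longrightarrow> qpow_derivative (Suc n) z h = real (Suc n) *\<^sub>R (z ^ n * h)"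
proof (induction n)
  case (Suc n)
  have "z ^ Suc n * h = h * z ^ Suc n"
    using Suc.prems by (metis power_commuting_commutes)
  then have "qpow_derivative (Suc (Suc n)) z h = z * qpow_derivative (Suc n) z h + z ^ Suc n * h" by simp
  also have "\<dots> = real (Suc (Suc n)) *\<^sub>R (z ^ Suc n * h)"
    unfolding Suc.IH [OF Suc.prems] by (simp add: scaleR_add_left mult.assoc del: of_nat_Suc) (simp add: algebra_simps scaleR_2)
  finally show ?case .
qed simp

definition right_powser :: "(nat \<Rightarrow> 'v::right_quat_hilbert) \<Rightarrow> quat \<Rightarrow> 'v"
  where "right_powser c z = (\<Sum>n. c n *\<^sub>H z ^ n)"

lemma right_powser_0: "right_powser c 0 = c 0"
  unfolding right_powser_def
  by (subst suminf_finite [of "{0}"]) (auto simp: qscale.zero_right qscale_one power_0_left)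

definition powser_converges :: "(nat \<Rightarrow> 'a::real_normed_vector) \<Rightarrow> real \<Rightarrow> bool"
  where "powser_converges c r \<longleftrightarrow> (\<forall>x::real. norm x < r \<longrightarrow> summable (\<lambda>n. norm (c n) * x ^ n))"

definition powser_deriv :: "(nat \<Rightarrow> 'a::real_normed_vector) \<Rightarrow> nat \<Rightarrow> 'a"
  where "powser_deriv c n = real (Suc n) *\<^sub>R c (Suc n)"

lemma powser_converges_deriv:
  assumes "powser_converges c r"
  shows "powser_converges (powser_deriv c) r"
  unfolding powser_converges_def
proof (intro allI impI)
  fix x :: real assume "norm x < r"
  then have "summable (\<lambda>n. diffs (\<lambda>n. norm (c n)) n * x ^ n)"
    by (rule termdiff_converges) (use assms in \<open>auto simp: powser_converges_def\<close>)
  then show "summable (\<lambda>n. norm (powser_deriv c n) * x ^ n)"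
    by (simp add: diffs_def powser_deriv_def)
qed

lemma powser_converges_geometric:
  assumes "0 < C" "\<And>n. norm (a n) \<le> K * C ^ n"
  shows "powser_converges a (inverse C)"
  unfolding powser_converges_def
proof (intro allI impI)
  fix x :: real assume x: "norm x < inverse C"
  then have x: "C * \<bar>x\<bar> < 1" using assms(1) by (simp add: field_simps)
  show "summable (\<lambda>n. norm (a n) * x ^ n)"
  proof (rule summable_comparison_test')
    show "summable (\<lambda>n. K * (C * \<bar>x\<bar>) ^ n)"
      using x assms(1) by (intro summable_mult summable_geometric) (simp add: abs_mult)
    show "norm (norm (a n) * x ^ n) \<le> K * (C * \<bar>x\<bar>) ^ n" for n
    proof -
      have "norm (a n) * \<bar>x\<bar> ^ n \<le> (K * C ^ n) * \<bar>x\<bar> ^ n" by (intro mult_right_mono assms) simp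
      then show ?thesis by (simp add: power_mult_distrib abs_mult power_abs mult_ac)
    qed
  qed
qed

lemma right_powser_sums:
  assumes "powser_converges c r" "norm z < r"
  shows "(\<lambda>n. c n *\<^sub>H z ^ n) sums right_powser c z"
  unfolding right_powser_def
proof (rule summable_sums, rule summable_norm_cancel)
  show "summable (\<lambda>n. norm (c n *\<^sub>H z ^ n))"
    using assms by (simp add: powser_converges_def norm_qscale norm_power)
qed

lemma right_powser_derivative_sums:
  assumes c: "powser_converges c r" and z: "norm z < r" and h: "z * h = h * z"
  shows "(\<lambda>n. c n *\<^sub>H qpow_derivative n z h) sums (right_powser (powser_deriv c) z *\<^sub>H h)"
proof -
  have "(\<lambda>n. powser_deriv c n *\<^sub>H z ^ n *\<^sub>H h) sums (right_powser (powser_deriv c) z *\<^sub>H h)"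
    by (intro bounded_linear.sums [OF qscale.bounded_linear_left] right_powser_sums [OF powser_converges_deriv [OF c] z])
  also have "(\<lambda>n. powser_deriv c n *\<^sub>H z ^ n *\<^sub>H h) = (\<lambda>n. c (Suc n) *\<^sub>H qpow_derivative (Suc n) z h)"
    unfolding qpow_derivative_commuting [OF h] powser_deriv_def
    by (simp only: qscale.scaleR_left qscale.scaleR_right qscale_qscale)
  finally show ?thesis by (subst (asm) sums_Suc_iff) (simp add: qscale.zero_right)
qed

text \<open>
  Termwise differentiation: on a slightly smaller ball the differentiated series is dominated by
  the differentiated real series of the norms of the coefficients.
\<close>

lemma right_powser_has_derivative:
  assumes c: "powser_converges c r" and z: "norm z < r"
  shows "(right_powser c has_derivative (\<lambda>h. \<Sum>n. c n *\<^sub>H qpow_derivative n z h)) (at z)"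
proof -
  obtain s where s: "norm z < s" "s < r" using dense [OF z] by blast
  have s0: "0 < s" using s norm_ge_zero order_le_less_trans by blast
  \<comment> \<open>The coefficients of the differentiated real series at \<open>s\<close>: a common bound on the ball of radius \<open>s\<close>.\<close>
  define b where "b n = norm (c n) * (real n * s ^ (n - 1))" for n
  have "summable (\<lambda>n. b (Suc n))"
    using powser_converges_deriv [OF c] s s0
    by (simp add: powser_converges_def powser_deriv_def b_def mult_ac del: of_nat_Suc)
  then have b: "summable b" by (simp add: summable_Suc_iff)
  let ?S = "ball (0::quat) s"
  have bound: "norm (c n *\<^sub>H qpow_derivative n x h) \<le> b n * norm h" if "x \<in> ?S" for n x h
  proof -
    have "norm (c n *\<^sub>H qpow_derivative n x h) \<le> norm (c n) * (real n * norm x ^ (n - 1) * norm h)"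
      unfolding norm_qscale by (intro mult_left_mono norm_qpow_derivative) simp
    also have "\<dots> \<le> norm (c n) * (real n * s ^ (n - 1) * norm h)"
      using that by (intro mult_left_mono mult_right_mono power_mono) auto
    finally show ?thesis by (simp add: b_def mult.assoc)
  qed
  have "\<exists>g. \<forall>x\<in>?S. (\<lambda>n. c n *\<^sub>H x ^ n) sums g x \<and>
      (g has_derivative (\<lambda>h. \<Sum>n. c n *\<^sub>H qpow_derivative n x h)) (at x within ?S)"
  proof (rule has_derivative_series)
    show "convex ?S" by (rule convex_ball)
    show "((\<lambda>x. c n *\<^sub>H x ^ n) has_derivative (\<lambda>h. c n *\<^sub>H qpow_derivative n x h)) (at x within ?S)" for n x
      by (rule bounded_linear.has_derivative [OF qscale.bounded_linear_right has_derivative_qpow])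
    show "0 \<in> ?S" using s0 by simp
    show "(\<lambda>n. c n *\<^sub>H 0 ^ n) sums right_powser c 0"
      by (rule right_powser_sums [OF c]) (use s s0 in simp)
    fix e :: real assume e: "0 < e"
    obtain N where N: "\<And>n. n \<ge> N \<Longrightarrow> norm (\<Sum>i. b (i + n)) < e"
      using suminf_exist_split [OF e b] by blast
    show "\<forall>\<^sub>F n in sequentially. \<forall>x\<in>?S. \<forall>h.
        norm ((\<Sum>i<n. c i *\<^sub>H qpow_derivative i x h) - (\<Sum>i. c i *\<^sub>H qpow_derivative i x h)) \<le> e * norm h"
      unfolding eventually_sequentially
    proof (intro exI [of _ N] allI impI ballI)
      fix n :: nat and x h :: quat assume n: "N \<le> n" and x: "x \<in> ?S"
      have bh: "summable (\<lambda>i. b (i + n) * norm h)"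
        using b by (intro summable_mult2) (simp add: summable_iff_shift)
      have sn: "summable (\<lambda>i. norm (c i *\<^sub>H qpow_derivative i x h))"
        by (rule summable_comparison_test' [OF summable_mult2 [OF b, of "norm h"], of 0])
          (use bound [OF x] in simp)
      then have sn': "summable (\<lambda>i. norm (c (i + n) *\<^sub>H qpow_derivative (i + n) x h))"
        by (subst summable_iff_shift)
      have "norm ((\<Sum>i<n. c i *\<^sub>H qpow_derivative i x h) - (\<Sum>i. c i *\<^sub>H qpow_derivative i x h))
          = norm (\<Sum>i. c (i + n) *\<^sub>H qpow_derivative (i + n) x h)"
        by (subst suminf_split_initial_segment [OF summable_norm_cancel [OF sn], of n]) simp
      also have "\<dots> \<le> (\<Sum>i. norm (c (i + n) *\<^sub>H qpow_derivative (i + n) x h))"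
        by (rule summable_norm [OF sn'])
      also have "\<dots> \<le> (\<Sum>i. b (i + n) * norm h)"
        by (rule suminf_le [OF bound [OF x] sn' bh])
      also have "\<dots> = (\<Sum>i. b (i + n)) * norm h"
        using b by (intro suminf_mult2 [symmetric]) (simp add: summable_iff_shift)
      also have "\<dots> \<le> e * norm h" using N [OF n] by (intro mult_right_mono) auto
      finally show "norm ((\<Sum>i<n. c i *\<^sub>H qpow_derivative i x h) - (\<Sum>i. c i *\<^sub>H qpow_derivative i x h)) \<le> e * norm h" .
    qed
  qed
  then obtain g where g: "\<And>x. x \<in> ?S \<Longrightarrow> (\<lambda>n. c n *\<^sub>H x ^ n) sums g x"
    "\<And>x. x \<in> ?S \<Longrightarrow> (g has_derivative (\<lambda>h. \<Sum>n. c n *\<^sub>H qpow_derivative n x h)) (at x within ?S)" by blast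
  have zS: "z \<in> ?S" using s by simp
  have "(g has_derivative (\<lambda>h. \<Sum>n. c n *\<^sub>H qpow_derivative n z h)) (at z)"
    using g(2) [OF zS] at_within_open [OF zS open_ball] by simp
  moreover have "g x = right_powser c x" if "x \<in> ?S" for x
    using sums_unique [OF g(1) [OF that]] by (simp add: right_powser_def)
  ultimately show ?thesis
    by (rule has_derivative_transform_within_open [OF _ open_ball zS])
qed

text \<open>
  In a commuting direction the termwise derivative is the usual one, and the resulting series
  converges on the same ball, so it is itself differentiable and hence continuous.
\<close>

lemma has_slice_derivative_on_right_powser:
  assumes c: "powser_converges c r"
  shows "has_slice_derivative_on (ball 0 r) (right_powser c) (right_powser (powser_deriv c))"
  unfolding has_slice_derivative_on_def
proof (intro conjI ballI)
  show "continuous_on (ball 0 r) (right_powser (powser_deriv c))"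
    using right_powser_has_derivative [OF powser_converges_deriv [OF c]]
    by (intro continuous_at_imp_continuous_on ballI has_derivative_continuous) auto
  fix z assume "z \<in> ball (0::quat) r"
  then have z: "norm z < r" by simp
  show "\<exists>D. (right_powser c has_derivative D) (at z) \<and>
      (\<forall>h. z * h = h * z \<longrightarrow> D h = right_powser (powser_deriv c) z *\<^sub>H h)"
    using right_powser_has_derivative [OF c z] right_powser_derivative_sums [OF c z]
    by (intro exI [of _ "\<lambda>h. \<Sum>n. c n *\<^sub>H qpow_derivative n z h"]) (auto simp: sums_unique [symmetric])
qed


section \<open>Slice-regular families of kernel vectors\<close>

text \<open>
  This supplies the initial coefficient of a family of kernel vectors that does not vanish at \<open>q\<close>.
  If \<open>A b = b *\<^sub>H qcnj q\<close> held on the whole kernel, then \<open>q\<close> would be real, and \<open>R_op q A\<close> would be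
  the square of an operator with the same kernel as that square; this contradicts that the nonzero
  kernel lies in the range.
\<close>

lemma R_op_kernel_vector_not_eigenvector:
  fixes A :: "'v::right_quat_hilbert \<Rightarrow> 'v"
  assumes A: "A \<in> bounded_ops" and k: "kato_regular (R_op q A)" and a: "a \<noteq> 0" "R_op q A a = 0"
  shows "\<exists>b. R_op q A b = 0 \<and> A b \<noteq> b *\<^sub>H qcnj q"
proof (rule ccontr)
  note Aq = bounded_opsD(2) [OF A]
  interpret A: bounded_linear A by (rule bounded_opsD [OF A])
  note RA = R_op_bounded_ops [OF A, of q]
  assume "\<not> ?thesis"
  then have eig: "A b = b *\<^sub>H qcnj q" if "R_op q A b = 0" for b using that by blast
  \<comment> \<open>The kernel is a right subspace, so the eigenvalue would commute with all scalars.\<close>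
  have "qcnj q * u = u * qcnj q" for u
  proof -
    have "R_op q A (a *\<^sub>H u) = 0" using a by (simp add: bounded_opsD(2) [OF RA] qscale.zero_left)
    from eig [OF this] have "a *\<^sub>H (qcnj q * u) = a *\<^sub>H (u * qcnj q)"
      by (simp add: Aq eig [OF a(2)] qscale_qscale)
    then have "a *\<^sub>H (qcnj q * u - u * qcnj q) = 0" by (simp add: qscale.diff_right)
    then show ?thesis using a(1) by (simp add: qscale_eq_0_iff)
  qed
  from this [of "Quat 0 1 0 0"] this [of "Quat 0 0 1 0"]
  have "q = of_real (qRe q)" by (simp add: quat_eq_iff)
  then obtain x where q: "q = of_real x" by blast
  have cq: "qcnj q = of_real x" by (simp add: q quat_eq_iff)
  \<comment> \<open>For real \<open>q\<close> the operator \<open>R_op q A\<close> is the square of \<open>N\<close>, and the assumption says that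
    \<open>N\<close> and its square have the same kernel, which then meets the range of the square trivially.\<close>
  define N where "N \<phi> = A \<phi> - x *\<^sub>R \<phi>" for \<phi>
  have R: "R_op q A \<phi> = N (N \<phi>)" for \<phi>
    by (simp add: R_op_def N_def q A.diff A.scaleR power2_eq_square algebra_simps scaleR_2 flip: scaleR_add_left)
  have ker: "N b = 0" if "R_op q A b = 0" for b
    using eig [OF that] by (simp add: N_def cq scaleR_eq_qscale)
  have "a \<in> range (R_op q A ^^ 1)" using k a(2) unfolding kato_regular_def by blast
  then obtain b where b: "a = N (N b)" by (auto simp: R)
  have N0: "N 0 = 0" by (simp add: N_def A.zero)
  have "N (N (N b)) = 0" using ker [OF a(2)] b by simp
  then have "R_op q A (N b) = 0" by (simp add: R N0)
  then have "N (N b) = 0" by (rule ker)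
  then show False using b a(1) by simp
qed

text \<open>
  On the power series of a backward orbit the operator \<open>T\<close> acts as right multiplication by the
  variable.
\<close>

lemma backward_orbit_powser_intertwines:
  assumes T: "T \<in> bounded_ops" and c: "powser_converges a r" and z: "norm z < r"
    and a: "T (a 0) = 0" "\<And>n. T (a (Suc n)) = a n"
  shows "T (right_powser a z) = right_powser a z *\<^sub>H z"
proof -
  note s = right_powser_sums [OF c z]
  have "(\<lambda>n. T (a n *\<^sub>H z ^ n)) sums T (right_powser a z)"
    by (rule bounded_linear.sums [OF bounded_opsD(1) [OF T] s])
  then have 1: "(\<lambda>n. T (a n) *\<^sub>H z ^ n) sums T (right_powser a z)" by (simp add: bounded_opsD(2) [OF T])
  have "(\<lambda>n. a n *\<^sub>H z ^ n *\<^sub>H z) sums (right_powser a z *\<^sub>H z)"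
    by (rule bounded_linear.sums [OF qscale.bounded_linear_left s])
  \<comment> \<open>Multiplying by \<open>z\<close> shifts the coefficients one place, as \<open>T\<close> does in the other direction.\<close>
  then have "(\<lambda>n. T (a (Suc n)) *\<^sub>H z ^ Suc n) sums (right_powser a z *\<^sub>H z)"
    by (simp add: a qscale_qscale power_commutes)
  then have "(\<lambda>n. T (a n) *\<^sub>H z ^ n) sums (right_powser a z *\<^sub>H z)"
    by (subst (asm) sums_Suc_iff) (simp add: a(1) qscale.zero_left)
  then show ?thesis using sums_unique2 [OF 1] by simp
qed

text \<open>
  The hypothesis amounts to \<open>A\<^sup>2 s - 2 Re(q) A s = s (p\<^sup>2 - 2 Re(q) p)\<close>, a quadratic equation for the
  action of \<open>A\<close> on \<open>s\<close> with the roots \<open>p\<close> and \<open>2 Re(q) - p\<close>. The combination \<open>A s + s (p - 2 Re(q))\<close>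
  removes the second root, so \<open>A\<close> acts on it as right multiplication by \<open>p\<close>; and \<open>p\<close> annihilates its
  own characteristic polynomial.
\<close>

lemma R_op_kernel_from_intertwining:
  assumes A: "A \<in> bounded_ops" and s: "R_op q A s = s *\<^sub>H qchar_poly q p"
  shows "R_op p A (A s + s *\<^sub>H (p - of_real (2 * qRe q))) = 0"
proof -
  note Aq = bounded_opsD(2) [OF A]
  interpret A: bounded_linear A by (rule bounded_opsD [OF A])
  let ?f = "A s + s *\<^sub>H (p - of_real (2 * qRe q))"
  \<comment> \<open>Eliminating \<open>A (A s)\<close> leaves an eigenvalue equation for \<open>?f\<close> with eigenvalue \<open>p\<close>.\<close>
  have "A (A s) = s *\<^sub>H qchar_poly q p + (2 * qRe q) *\<^sub>R A s - (norm q)\<^sup>2 *\<^sub>R s"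
    using s by (simp add: R_op_def algebra_simps)
  then have "A ?f = s *\<^sub>H qchar_poly q p + (2 * qRe q) *\<^sub>R A s - (norm q)\<^sup>2 *\<^sub>R s + A s *\<^sub>H (p - of_real (2 * qRe q))"
    by (simp only: A.add Aq)
  also have "\<dots> = s *\<^sub>H (qchar_poly q p - of_real ((norm q)\<^sup>2)) + A s *\<^sub>H p"
    by (simp add: scaleR_eq_qscale qscale.diff_right)
  also have "qchar_poly q p - of_real ((norm q)\<^sup>2) = (p - of_real (2 * qRe q)) * p"
    by (simp add: qchar_poly_def left_diff_distrib of_real_def)
  finally have eig: "A ?f = ?f *\<^sub>H p" by (simp only: qscale_add_left qscale_qscale add.commute)
  have "R_op p A ?f = ?f *\<^sub>H qchar_poly p p"
    unfolding R_op_def eig Aq qchar_poly_def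
    by (simp only: qscale_qscale qscale.add_right qscale.diff_right qscale.scaleR_right eig) (simp only: scaleR_eq_qscale)
  then show ?thesis by (simp add: qchar_poly_self qscale.zero_right)
qed

text \<open>
  The heart of the matter: where \<open>R_op q A\<close> is Kato regular but not bounded below, a kernel vector
  extends to a slice-regular family of kernel vectors. With a backward orbit \<open>a\<close> of \<open>R_op q A\<close> put
  \<open>S p = \<Sum>n. a n *\<^sub>H (qchar_poly q p) ^ n\<close>; then \<open>R_op q A (S p) = S p *\<^sub>H qchar_poly q p\<close>, and
  \<open>f p = A (S p) + S p *\<^sub>H (p - 2 Re(q))\<close> is the required family. One formula covers real and
  non-real \<open>q\<close>.
\<close>

lemma kato_approx_subset_analytic_residuum:
  fixes A :: "'v::right_quat_hilbert \<Rightarrow> 'v"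
  assumes A: "A \<in> bounded_ops"
  shows "kato_S_resolvent A \<inter> approx_S_spectrum A \<subseteq> analytic_residuum A"
proof
  fix q assume "q \<in> kato_S_resolvent A \<inter> approx_S_spectrum A"
  then have k: "kato_regular (R_op q A)" and nb: "\<not> bounded_below (R_op q A)"
    by (auto simp: kato_S_resolvent_eq approx_S_spectrum_eq [OF A])
  note T = R_op_bounded_linear [OF A, of q]
  obtain k0 where "k0 \<noteq> 0" "R_op q A k0 = 0" by (rule kato_regular_kernel_nontrivial [OF T k nb])
  then obtain a0 where a0: "R_op q A a0 = 0" "A a0 \<noteq> a0 *\<^sub>H qcnj q"
    using R_op_kernel_vector_not_eigenvector [OF A k] by blast
  obtain a C where a: "a 0 = a0" "\<And>n. R_op q A (a (Suc n)) = a n" "0 < C" "\<And>n. norm (a n) \<le> norm a0 * C ^ n"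
    by (rule kato_regular_backward_orbit [OF T k a0(1)]) blast
  have conv: "powser_converges a (inverse C)" by (rule powser_converges_geometric [OF a(3,4)])
  define S where "S p = right_powser a (qchar_poly q p)" for p
  define f where "f p = A (S p) + S p *\<^sub>H (p - of_real (2 * qRe q))" for p
  define V where "V = qchar_poly q -` ball 0 (inverse C)"
  have V: "open V" unfolding V_def by (intro open_vimage continuous_on_qchar_poly) simp
  obtain g where g: "has_slice_derivative_on V S g"
    using has_slice_derivative_on_compose_qchar_poly [OF has_slice_derivative_on_right_powser [OF conv], of q V]
    unfolding S_def V_def by blast
  obtain g' where f: "has_slice_derivative_on V f g'"
    using has_slice_derivative_on_add [OF has_slice_derivative_on_bounded_op [OF A g] has_slice_derivative_on_times_linear [OF g]]
    unfolding f_def by blast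
  define U where "U = V \<inter> f -` (- {0})"
  have U: "open U" unfolding U_def
    by (rule continuous_open_preimage [OF has_slice_derivative_on_continuous [OF f] V]) (simp add: open_Compl)
  have "S q = a0" by (simp add: S_def qchar_poly_self right_powser_0 a(1))
  \<comment> \<open>At \<open>q\<close> only the constant coefficient survives, and \<open>f q\<close> is the defect of \<open>a0\<close> from being an
    eigenvector for \<open>qcnj q\<close>.\<close>
  moreover have "q - of_real (2 * qRe q) = - qcnj q" by (simp add: quat_eq_iff del: of_real_mult)
  ultimately have "f q \<noteq> 0" using a0(2) by (simp add: f_def qscale.minus_right)
  then have qU: "q \<in> U" using a(3) by (simp add: U_def V_def qchar_poly_self)
  have fU: "has_slice_derivative_on U f g'"
    using f unfolding has_slice_derivative_on_def U_def by (auto intro: continuous_on_subset)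
  have "R_op p A (f p) = 0" if "p \<in> U" for p
  proof -
    have "R_op q A (S p) = S p *\<^sub>H qchar_poly q p" unfolding S_def
    proof (rule backward_orbit_powser_intertwines [OF R_op_bounded_ops [OF A] conv])
      show "norm (qchar_poly q p) < inverse C" using that by (simp add: U_def V_def)
    qed (simp_all add: a a0)
    then show ?thesis unfolding f_def by (rule R_op_kernel_from_intertwining [OF A])
  qed
  moreover have "\<forall>p\<in>U. f p \<noteq> 0" by (simp add: U_def)
  ultimately show "q \<in> analytic_residuum A"
    unfolding analytic_residuum_def
    using U qU has_slice_derivative_on_continuous [OF fU] has_slice_derivative_on_slice_regular [OF fU] by blast
qed


section \<open>Decomposition of the S-spectrum\<close>

theorem proposition7p12:
  fixes A :: "'v::right_quat_hilbert \<Rightarrow> 'v"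
  assumes "A \<in> bounded_ops"
  shows "kato_S_resolvent A = kato_S_resolvent (adj_op A)
    \<and> kato_S_resolvent A \<inter> S_spectrum A \<subseteq> analytic_residuum A \<union> analytic_residuum (adj_op A)
    \<and> (frontier (S_spectrum A)
          \<subseteq> (approx_S_spectrum A \<inter> surj_S_spectrum A)
             - (analytic_residuum A \<inter> analytic_residuum (adj_op A))
       \<and> (approx_S_spectrum A \<inter> surj_S_spectrum A)
             - (analytic_residuum A \<inter> analytic_residuum (adj_op A))
          \<subseteq> kato_S_spectrum A
       \<and> kato_S_spectrum A \<subseteq> approx_S_spectrum A \<inter> surj_S_spectrum A)
    \<and> (approx_S_spectrum A \<inter> surj_S_spectrum A)
          - (analytic_residuum A \<inter> analytic_residuum (adj_op A))
        = (approx_S_spectrum A - analytic_residuum A)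
          \<union> (surj_S_spectrum A - analytic_residuum (adj_op A))"
proof -
  note A = assms and B = adj_op_props(1) [OF assms]
  have kato: "kato_S_resolvent A = kato_S_resolvent (adj_op A)"
    using kato_S_resolvent_adj_subset [OF A] kato_S_resolvent_adj_subset [OF B]
    by (simp add: adj_op_props(3) [OF A] subset_antisym)
  have su: "surj_S_spectrum A = approx_S_spectrum (adj_op A)"
    by (rule surj_S_spectrum_eq_approx_adj [OF A])
  have sp: "S_spectrum A = approx_S_spectrum A \<union> surj_S_spectrum A" by (rule S_spectrum_eq [OF A])
  have an: "kato_S_resolvent A \<inter> approx_S_spectrum A \<subseteq> analytic_residuum A"
    by (rule kato_approx_subset_analytic_residuum [OF A])
  have an': "kato_S_resolvent A \<inter> surj_S_spectrum A \<subseteq> analytic_residuum (adj_op A)"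
    using kato_approx_subset_analytic_residuum [OF B] by (simp add: kato su)
  have ka: "kato_S_spectrum A \<subseteq> approx_S_spectrum A \<inter> surj_S_spectrum A"
    using bounded_below_imp_kato_regular [OF R_op_bounded_linear [OF A]] surj_imp_kato_regular
    by (auto simp: kato_S_spectrum_def kato_S_resolvent_eq approx_S_spectrum_eq [OF A] surj_S_spectrum_def)
  have fr: "frontier (S_spectrum A) \<subseteq> approx_S_spectrum A \<inter> surj_S_spectrum A"
    using frontier_S_spectrum_subset_approx [OF A] frontier_S_spectrum_subset_approx [OF B]
    by (simp add: S_spectrum_adj_op [OF A] su)
  have int: "analytic_residuum A \<inter> frontier (S_spectrum A) = {}"
    using analytic_residuum_subset_interior [OF A] by (auto simp: frontier_def)
  show ?thesis
    using kato sp an an' ka fr int unfolding kato_S_spectrum_def by (intro conjI) blast+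
qed

end
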